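(* There exists a real number that is regainingly approximable and nearly computable but not computable.
   Context: A real $x$ is computable if there is a computable sequence of rationals $(x_n)_n$ with $|x-x_n|<2^{-n}$ for all $n$. A real $x$ is regainingly approximable if there is a computable non-decreasing sequence of rationals $(x_n)_n$ converging to $x$ with $x - x_n < 2^{-n}$ for infinitely many $n\in\mathbb{N}$. A function $f:\mathbb{N}\to\mathbb{N}$ is a modulus of convergence of a convergent sequence $(y_n)_n$ with limit $y$ if for all $n$ and all $m\ge f(n)$ we have $|y-y_m|<2^{-n}$; $(y_n)_n$ converges computably if it has a computable modulus of convergence. A sequence $(x_n)_n$ converges nearly computably if it converges and for every computable increasing function $s:\mathbb{N}\to\mathbb{N}$ the sequence $(x_{s(n+1)}-x_{s(n)})_n$ converges computably to $0$. A real is nearly computable if some computable sequence of rationals converges nearly computably to it. *)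

theory Defs
  imports Complex_Main
begin

datatype recf = Z | S | Id nat | Cn recf "recf list" | Pr recf recf | Mn recf

inductive eval :: "recf \<Rightarrow> nat list \<Rightarrow> nat \<Rightarrow> bool" where
  eval_Z: "eval Z xs 0"
| eval_S: "eval S (x # xs) (Suc x)"
| eval_Id: "i < length xs \<Longrightarrow> eval (Id i) xs (xs ! i)"
| eval_Cn: "\<lbrakk> length ys = length gs; \<forall>i < length gs. eval (gs ! i) xs (ys ! i);
              eval f ys y \<rbrakk> \<Longrightarrow> eval (Cn f gs) xs y"
| eval_Pr0: "eval f xs y \<Longrightarrow> eval (Pr f g) (0 # xs) y"
| eval_PrS: "\<lbrakk> eval (Pr f g) (n # xs) y; eval g (n # y # xs) z \<rbrakk>
              \<Longrightarrow> eval (Pr f g) (Suc n # xs) z"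
| eval_Mn: "\<lbrakk> eval f (n # xs) 0; \<forall>m < n. \<exists>y. eval f (m # xs) y \<and> y \<noteq> 0 \<rbrakk>
              \<Longrightarrow> eval (Mn f) xs n"

definition computable_nat :: "(nat \<Rightarrow> nat) \<Rightarrow> bool" where
  "computable_nat f \<longleftrightarrow> (\<exists>r. \<forall>n. eval r [n] (f n))"

definition computable_rat_seq :: "(nat \<Rightarrow> rat) \<Rightarrow> bool" where
  "computable_rat_seq q \<longleftrightarrow> (\<exists>a b c. computable_nat a \<and> computable_nat b \<and> computable_nat c \<and>
      (\<forall>n. q n = (of_nat (a n) - of_nat (b n)) / of_nat (Suc (c n))))"

definition computable_real :: "real \<Rightarrow> bool" where
  "computable_real x \<longleftrightarrow> (\<exists>q. computable_rat_seq q \<and>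
      (\<forall>n. \<bar>x - real_of_rat (q n)\<bar> < (1/2) ^ n))"

definition regainingly_approximable :: "real \<Rightarrow> bool" where
  "regainingly_approximable x \<longleftrightarrow> (\<exists>q. computable_rat_seq q \<and> mono q \<and>
      (\<lambda>n. real_of_rat (q n)) \<longlonglongrightarrow> x \<and>
      infinite {n. x - real_of_rat (q n) < (1/2) ^ n})"

definition is_modulus :: "(nat \<Rightarrow> nat) \<Rightarrow> (nat \<Rightarrow> real) \<Rightarrow> real \<Rightarrow> bool" where
  "is_modulus f y L \<longleftrightarrow> (\<forall>n m. f n \<le> m \<longrightarrow> \<bar>L - y m\<bar> < (1/2) ^ n)"

definition converges_computably_to :: "(nat \<Rightarrow> real) \<Rightarrow> real \<Rightarrow> bool" where
  "converges_computably_to y L \<longleftrightarrow> y \<longlonglongrightarrow> L \<and> (\<exists>f. computable_nat f \<and> is_modulus f y L)"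

definition converges_nearly_computably_to :: "(nat \<Rightarrow> real) \<Rightarrow> real \<Rightarrow> bool" where
  "converges_nearly_computably_to x L \<longleftrightarrow> x \<longlonglongrightarrow> L \<and>
     (\<forall>s. computable_nat s \<and> strict_mono s \<longrightarrow>
        converges_computably_to (\<lambda>n. x (s (Suc n)) - x (s n)) 0)"

definition nearly_computable :: "real \<Rightarrow> bool" where
  "nearly_computable x \<longleftrightarrow> (\<exists>q. computable_rat_seq q \<and>
      converges_nearly_computably_to (\<lambda>n. real_of_rat (q n)) x)"

end

theory Submission
  imports Defs "HOL-Library.Nat_Bijection"
begin

text \<open>
  Programs \<open>i\<close> enumerate sets of stages; \<open>seen i t\<close> is the largest element enumerated by stage \<open>t\<close>.  For
  every \<open>m\<close> there is an attempt (row \<open>m\<close>) that sends one unit of flow per stage through gates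
  \<open>0, 1, 2, \<dots>\<close>.  Gate \<open>i\<close> is transparent until \<open>seen i\<close> reaches \<open>m\<close>, so a program with finite output
  does not obstruct late rows.  From then on the gate works in intervals: during the interval that
  starts at stage \<open>b\<close> it damps the flow by \<open>2\<^sup>-\<^sup>b\<close>, it closes when an amount of at least 1 has passed, and
  it then waits for program \<open>i\<close> to enumerate an element \<open>\<ge> b\<close> before it ticks, that is, starts the
  next interval.  The flow that passes gate \<open>e\<close> of row \<open>m\<close> during its second interval is added to the
  approximation with weight \<open>8\<^sup>-\<^sup>(\<^sup>m\<^sup>+\<^sup>1\<^sup>)\<close>, and then all rows between \<open>m\<close> and the current stage are
  discarded.

  The limit is not computable: a modulus \<open>f\<close> gives a program \<open>e\<close> enumerating \<open>s\<close> with \<open>s (n + 1) > f (s n)\<close>,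
  so the second tick of gate \<open>e\<close> in row \<open>m\<close> comes after stage \<open>f (s n)\<close> for some \<open>s n \<ge> m\<close>, but an amount
  of at least \<open>8\<^sup>-\<^sup>(\<^sup>m\<^sup>+\<^sup>1\<^sup>)\<close> is still to be added.  It is regainingly approximable: infinitely many rows \<open>m\<close>
  are never discarded, and after stage \<open>m\<close> only rows \<open>\<ge> m\<close> contribute.  It is nearly computable: if
  program \<open>i\<close> enumerates the range of \<open>s\<close>, then gate \<open>i\<close> ticks at most once between \<open>s n\<close> and
  \<open>s (n + 1)\<close>, so at most 4 units pass it; the first gate above \<open>i\<close> that is not transparent has, after
  a computable stage, either closed or damps these units by \<open>2\<^sup>-\<^sup>k\<close>.
\<close>

section \<open>Closure properties of recursive functions\<close>

text \<open>Only lists of length \<open>k\<close> matter, so that functions of several arguments can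
  be written with \<open>xs ! i\<close>.\<close>

definition recfn :: "nat \<Rightarrow> (nat list \<Rightarrow> nat) \<Rightarrow> bool" where
  "recfn k f \<longleftrightarrow> (\<exists>r. \<forall>xs. length xs = k \<longrightarrow> eval r xs (f xs))"

definition recdec :: "nat \<Rightarrow> (nat list \<Rightarrow> bool) \<Rightarrow> bool" where
  "recdec k P \<longleftrightarrow> recfn k (\<lambda>xs. of_bool (P xs))"

named_theorems recfn_intros

lemma recfn_comp_list:
  assumes f: "recfn (length gs) f" and gs: "\<forall>g \<in> set gs. recfn k g"
  shows "recfn k (\<lambda>xs. f (map (\<lambda>g. g xs) gs))"
proof -
  obtain r where r: "\<And>xs. length xs = length gs \<Longrightarrow> eval r xs (f xs)"
    using f unfolding recfn_def by blast
  have "\<forall>g \<in> set gs. \<exists>r. \<forall>xs. length xs = k \<longrightarrow> eval r xs (g xs)"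
    using gs unfolding recfn_def by blast
  then obtain c where c: "\<And>g xs. g \<in> set gs \<Longrightarrow> length xs = k \<Longrightarrow> eval (c g) xs (g xs)"
    by metis
  have "eval (Cn r (map c gs)) xs (f (map (\<lambda>g. g xs) gs))" if "length xs = k" for xs
    by (rule eval_Cn[where ys = "map (\<lambda>g. g xs) gs"]) (use that c r in auto)
  then show ?thesis unfolding recfn_def by blast
qed

lemma recfn_comp1:
  assumes "recfn 1 (\<lambda>xs. F (xs!0))" "recfn k a"
  shows "recfn k (\<lambda>xs. F (a xs))"
  using recfn_comp_list[of "[a]" "\<lambda>xs. F (xs!0)" k] assms by simp

lemma recfn_comp2:
  assumes "recfn 2 (\<lambda>xs. F (xs!0) (xs!1))" "recfn k a" "recfn k b"
  shows "recfn k (\<lambda>xs. F (a xs) (b xs))"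
  using recfn_comp_list[of "[a,b]" "\<lambda>xs. F (xs!0) (xs!1)" k] assms
  by (simp add: numeral_2_eq_2)

lemma recfn_comp3:
  assumes "recfn 3 (\<lambda>xs. F (xs!0) (xs!1) (xs!2))" "recfn k a" "recfn k b" "recfn k c"
  shows "recfn k (\<lambda>xs. F (a xs) (b xs) (c xs))"
  using recfn_comp_list[of "[a,b,c]" "\<lambda>xs. F (xs!0) (xs!1) (xs!2)" k] assms
  by (simp add: numeral_3_eq_3 numeral_2_eq_2)

lemma recfn_comp5:
  assumes "recfn 5 (\<lambda>xs. F (xs!0) (xs!1) (xs!2) (xs!3) (xs!4))"
    "recfn k a" "recfn k b" "recfn k c" "recfn k d" "recfn k e"
  shows "recfn k (\<lambda>xs. F (a xs) (b xs) (c xs) (d xs) (e xs))"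
  using recfn_comp_list[of "[a,b,c,d,e]" "\<lambda>xs. F (xs!0) (xs!1) (xs!2) (xs!3) (xs!4)" k] assms
  by (simp add: eval_nat_numeral)

lemma recfn_cong:
  assumes "recfn k f" "\<And>xs. length xs = k \<Longrightarrow> f xs = g xs"
  shows "recfn k g"
  using assms unfolding recfn_def by metis

lemma recfn_nth [recfn_intros]: "i < k \<Longrightarrow> recfn k (\<lambda>xs. xs ! i)"
  unfolding recfn_def by (metis eval_Id)

text \<open>Below a binder the outer argument list appears as \<open>drop 1 zs\<close> or
  \<open>drop 2 zs\<close>; this rule and the next recognise projections below one and two
  binders.\<close>

lemma recfn_nth_drop [recfn_intros]:
  assumes "d + i < k" shows "recfn k (\<lambda>xs. drop d xs ! i)"
  by (rule recfn_cong[OF recfn_nth[OF assms]]) (use assms in simp)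

lemma recfn_nth_drop2 [recfn_intros]:
  assumes "d + c + i < k" shows "recfn k (\<lambda>xs. drop c (drop d xs) ! i)"
  by (rule recfn_cong[OF recfn_nth[OF assms]]) (use assms in \<open>simp add: add.commute\<close>)

lemma recfn_Suc_aux: "recfn 1 (\<lambda>xs. Suc (xs!0))"
proof -
  have "eval S xs (Suc (xs!0))" if "length xs = 1" for xs
    using that eval_S[of "xs!0" "[]"] by (cases xs) auto
  then show ?thesis unfolding recfn_def by blast
qed

lemmas recfn_Suc [recfn_intros] = recfn_comp1[OF recfn_Suc_aux]

lemma recfn_const [recfn_intros]: "recfn k (\<lambda>xs. c)"
proof (induction c)
  case 0
  show ?case unfolding recfn_def using eval_Z by metis
next
  case (Suc c)
  then show ?case by (rule recfn_Suc)
qed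

text \<open>\<open>Pr\<close> expects the counter in front of the parameters. Composing with
  \<open>h\<close> followed by all projections puts it there, so any recursive function may bound
  the recursion.\<close>

lemma recfn_rec_nat:
  assumes f: "recfn k f" and h: "recfn k h"
    and g: "recfn (Suc (Suc k)) (\<lambda>zs. g (zs!0) (zs!1) (drop 2 zs))"
  shows "recfn k (\<lambda>xs. rec_nat (f xs) (\<lambda>n y. g n y xs) (h xs))"
proof -
  obtain rf where rf: "\<And>xs. length xs = k \<Longrightarrow> eval rf xs (f xs)"
    using f unfolding recfn_def by blast
  obtain rg where rg: "\<And>zs. length zs = Suc (Suc k) \<Longrightarrow> eval rg zs (g (zs!0) (zs!1) (drop 2 zs))"
    using g unfolding recfn_def by blast
  have rg': "eval rg (n # y # xs) (g n y xs)" if "length xs = k" for n y xs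
    using rg[of "n # y # xs"] that by simp
  have Pr: "eval (Pr rf rg) (n # xs) (rec_nat (f xs) (\<lambda>n y. g n y xs) n)" if "length xs = k" for n xs
  proof (induction n)
    case 0
    show ?case using eval_Pr0[OF rf[OF that]] by simp
  next
    case (Suc n)
    show ?case using eval_PrS[OF Suc rg'[OF that]] by simp
  qed
  have "recfn (Suc k) (\<lambda>zs. rec_nat (f (drop 1 zs)) (\<lambda>n y. g n y (drop 1 zs)) (zs!0))"
    unfolding recfn_def
  proof (intro exI allI impI)
    fix zs :: "nat list" assume "length zs = Suc k"
    then show "eval (Pr rf rg) zs (rec_nat (f (drop 1 zs)) (\<lambda>n y. g n y (drop 1 zs)) (zs!0))"
      using Pr by (cases zs) auto
  qed
  moreover define gs :: "(nat list \<Rightarrow> nat) list" where "gs = h # map (\<lambda>i xs. xs ! i) [0..<k]"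
  ultimately have "recfn k (\<lambda>xs. (\<lambda>zs. rec_nat (f (drop 1 zs)) (\<lambda>n y. g n y (drop 1 zs)) (zs!0))
      (map (\<lambda>g. g xs) gs))"
    using h by (intro recfn_comp_list) (auto intro: recfn_nth)
  moreover have "map (\<lambda>g. g xs) gs = h xs # xs" if "length xs = k" for xs
    using that by (auto simp: gs_def o_def intro: nth_equalityI)
  ultimately show ?thesis
    by (elim recfn_cong) simp
qed

lemma recfn_add [recfn_intros]:
  assumes "recfn k f" "recfn k g" shows "recfn k (\<lambda>xs. f xs + g xs)"
proof -
  have "rec_nat a (\<lambda>n y. Suc y) b = a + b" for a b by (induction b) auto
  moreover have "recfn k (\<lambda>xs. rec_nat (f xs) (\<lambda>n y. Suc y) (g xs))"
    by (intro recfn_rec_nat recfn_intros assms) simp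
  ultimately show ?thesis by simp
qed

lemma recfn_mult [recfn_intros]:
  assumes "recfn k f" "recfn k g" shows "recfn k (\<lambda>xs. f xs * g xs)"
proof -
  have "rec_nat 0 (\<lambda>n y. y + a) b = a * b" for a b :: nat by (induction b) auto
  moreover have "recfn 2 (\<lambda>xs. rec_nat 0 (\<lambda>n y. y + xs!0) (xs!1))"
    by (intro recfn_rec_nat recfn_intros) simp_all
  ultimately show ?thesis using recfn_comp2[OF _ assms, of "(*)"] by simp
qed

lemma recfn_diff [recfn_intros]:
  assumes "recfn k f" "recfn k g" shows "recfn k (\<lambda>xs. f xs - g xs)"
proof -
  have "rec_nat 0 (\<lambda>n y. n) b = b - 1" for b by (cases b) auto
  moreover have "recfn 1 (\<lambda>xs. rec_nat 0 (\<lambda>n y. n) (xs!0))"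
    by (intro recfn_rec_nat recfn_intros) simp_all
  ultimately have pred: "recfn 1 (\<lambda>xs. xs!0 - 1)" by simp
  have "rec_nat a (\<lambda>n y. y - 1) b = a - b" for a b :: nat by (induction b) auto
  moreover have "recfn k (\<lambda>xs. rec_nat (f xs) (\<lambda>n y. y - 1) (g xs))"
    by (intro recfn_rec_nat recfn_comp1[OF pred] recfn_intros assms) simp
  ultimately show ?thesis by simp
qed

lemma recfn_power [recfn_intros]:
  assumes "recfn k f" "recfn k g" shows "recfn k (\<lambda>xs. f xs ^ g xs)"
proof -
  have "rec_nat 1 (\<lambda>n y. y * a) b = a ^ b" for a b :: nat by (induction b) auto
  moreover have "recfn 2 (\<lambda>xs. rec_nat 1 (\<lambda>n y. y * xs!0) (xs!1))"
    by (intro recfn_rec_nat recfn_intros) simp_all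
  ultimately show ?thesis using recfn_comp2[OF _ assms, of "(^)"] by simp
qed

lemma recfn_sum [recfn_intros]:
  assumes h: "recfn k h" and g: "recfn (Suc k) (\<lambda>zs. g (zs!0) (drop 1 zs))"
  shows "recfn k (\<lambda>xs. \<Sum>j<h xs. g j xs)"
proof -
  have "rec_nat 0 (\<lambda>n y. y + g n xs) b = (\<Sum>j<b. g j xs)" for b xs by (induction b) auto
  moreover have "recfn k (\<lambda>xs. rec_nat 0 (\<lambda>n y. y + g n xs) (h xs))"
  proof (intro recfn_rec_nat recfn_intros h)
    \<comment> \<open>The recursion step sees counter, accumulator and parameters; these projections
      skip the accumulator, which is no argument of the summand.\<close>
    define gs :: "(nat list \<Rightarrow> nat) list" where "gs = map (\<lambda>i xs. xs ! i) (0 # [2..<Suc (Suc k)])"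
    have "recfn (Suc (Suc k)) (\<lambda>xs. (\<lambda>zs. g (zs!0) (drop 1 zs)) (map (\<lambda>g. g xs) gs))"
    proof (rule recfn_comp_list)
      show "recfn (length gs) (\<lambda>zs. g (zs ! 0) (drop 1 zs))" using g by (simp add: gs_def del: upt_Suc)
      show "\<forall>g\<in>set gs. recfn (Suc (Suc k)) g" by (auto simp: gs_def intro: recfn_nth)
    qed
    moreover have "map (\<lambda>g. g xs) gs = xs!0 # drop 2 xs" if "length xs = Suc (Suc k)" for xs
    proof -
      have "map ((!) xs) [2..<length xs] = drop 2 xs"
        by (rule nth_equalityI) auto
      with that show ?thesis by (simp add: gs_def o_def)
    qed
    ultimately show "recfn (Suc (Suc k)) (\<lambda>xs. g (xs!0) (drop 2 xs))"
      by (elim recfn_cong) simp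
  qed simp_all
  ultimately show ?thesis by simp
qed

lemma recfn_of_bool [recfn_intros]: "recdec k P \<Longrightarrow> recfn k (\<lambda>xs. of_bool (P xs))"
  by (simp add: recdec_def)

lemma recdec_not [recfn_intros]:
  assumes "recdec k P" shows "recdec k (\<lambda>xs. \<not> P xs)"
proof -
  have "recfn k (\<lambda>xs. 1 - of_bool (P xs))" using assms by (intro recfn_intros)
  then show ?thesis unfolding recdec_def by (rule recfn_cong) simp
qed

lemma recdec_conj [recfn_intros]:
  assumes "recdec k P" "recdec k Q" shows "recdec k (\<lambda>xs. P xs \<and> Q xs)"
proof -
  have "recfn k (\<lambda>xs. of_bool (P xs) * of_bool (Q xs))" using assms by (intro recfn_intros)
  then show ?thesis unfolding recdec_def by (rule recfn_cong) simp
qed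

lemma recdec_disj [recfn_intros]:
  assumes "recdec k P" "recdec k Q" shows "recdec k (\<lambda>xs. P xs \<or> Q xs)"
proof -
  have "recdec k (\<lambda>xs. \<not> (\<not> P xs \<and> \<not> Q xs))" using assms by (intro recfn_intros)
  then show ?thesis by simp
qed

lemma recdec_imp [recfn_intros]:
  assumes "recdec k P" "recdec k Q" shows "recdec k (\<lambda>xs. P xs \<longrightarrow> Q xs)"
proof -
  have "recdec k (\<lambda>xs. \<not> P xs \<or> Q xs)" using assms by (intro recfn_intros)
  then show ?thesis by simp
qed

lemma recdec_le [recfn_intros]:
  assumes "recfn k f" "recfn k g" shows "recdec k (\<lambda>xs. f xs \<le> g xs)"
proof -
  have "recfn k (\<lambda>xs. 1 - (f xs - g xs))" using assms by (intro recfn_intros)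
  then show ?thesis unfolding recdec_def by (rule recfn_cong) simp
qed

lemma recdec_less [recfn_intros]:
  assumes "recfn k f" "recfn k g" shows "recdec k (\<lambda>xs. f xs < g xs)"
proof -
  have "recdec k (\<lambda>xs. \<not> g xs \<le> f xs)" using assms by (intro recfn_intros)
  then show ?thesis by (simp add: not_le)
qed

lemma recdec_eq [recfn_intros]:
  assumes "recfn k f" "recfn k g" shows "recdec k (\<lambda>xs. f xs = g xs)"
proof -
  have "recdec k (\<lambda>xs. f xs \<le> g xs \<and> g xs \<le> f xs)" using assms by (intro recfn_intros)
  then show ?thesis by (simp add: eq_iff)
qed

text \<open>A finite set is hard-wired into the program. This nonuniform fact later allows a modulus
  to use the set of those programs, among finitely many, whose output is unbounded.\<close>

lemma recdec_mem_finite [recfn_intros]: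
  assumes "finite A" "recfn k f" shows "recdec k (\<lambda>xs. f xs \<in> A)"
  using assms(1)
proof induction
  case empty
  show ?case by (simp add: recdec_def recfn_const)
next
  case (insert a A)
  have "recdec k (\<lambda>xs. f xs = a \<or> f xs \<in> A)" using assms insert by (intro recfn_intros)
  then show ?case by simp
qed

lemma recdec_all_less [recfn_intros]:
  assumes h: "recfn k h" and P: "recdec (Suc k) (\<lambda>zs. P (zs!0) (drop 1 zs))"
  shows "recdec k (\<lambda>xs. \<forall>j<h xs. P j xs)"
proof -
  have "recdec k (\<lambda>xs. (\<Sum>j<h xs. of_bool (\<not> P j xs)) = (0::nat))"
    using assms by (intro recfn_intros)
  moreover have "((\<Sum>j<h xs. of_bool (\<not> P j xs)) = (0::nat)) = (\<forall>j<h xs. P j xs)" for xs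
    by auto
  ultimately show ?thesis by simp
qed

lemma recdec_ex_less [recfn_intros]:
  assumes h: "recfn k h" and P: "recdec (Suc k) (\<lambda>zs. P (zs!0) (drop 1 zs))"
  shows "recdec k (\<lambda>xs. \<exists>j<h xs. P j xs)"
proof -
  have "recdec k (\<lambda>xs. \<not> (\<forall>j<h xs. \<not> P j xs))"
    using assms by (intro recfn_intros)
  then show ?thesis by simp
qed

lemma recfn_if [recfn_intros]:
  assumes "recdec k P" "recfn k f" "recfn k g"
  shows "recfn k (\<lambda>xs. if P xs then f xs else g xs)"
proof -
  have "recfn k (\<lambda>xs. of_bool (P xs) * f xs + of_bool (\<not> P xs) * g xs)"
    using assms by (intro recfn_intros)
  then show ?thesis by (rule recfn_cong) simp
qed

lemma recfn_max [recfn_intros]: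
  assumes "recfn k f" "recfn k g" shows "recfn k (\<lambda>xs. max (f xs) (g xs))"
  unfolding max_def using assms by (intro recfn_intros)

lemma recfn_Least:
  assumes P: "recdec (Suc k) (\<lambda>zs. P (zs!0) (drop 1 zs))"
    and ex: "\<And>xs. length xs = k \<Longrightarrow> \<exists>t. P t xs"
  shows "recfn k (\<lambda>xs. LEAST t. P t xs)"
proof -
  have "recfn (Suc k) (\<lambda>zs. of_bool (\<not> P (zs!0) (drop 1 zs)))"
    using P by (intro recfn_intros)
  then obtain r where r: "\<And>zs. length zs = Suc k \<Longrightarrow> eval r zs (of_bool (\<not> P (zs!0) (drop 1 zs)))"
    unfolding recfn_def by blast
  have r': "eval r (t # xs) (of_bool (\<not> P t xs))" if "length xs = k" for t xs
    using r[of "t # xs"] that by simp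
  have "eval (Mn r) xs (LEAST t. P t xs)" if len: "length xs = k" for xs
  proof (rule eval_Mn)
    have "P (LEAST t. P t xs) xs" using ex[OF len] by (rule LeastI_ex)
    then show "eval r ((LEAST t. P t xs) # xs) 0" using r'[OF len, of "LEAST t. P t xs"] by simp
    show "\<forall>m<LEAST t. P t xs. \<exists>y. eval r (m # xs) y \<and> y \<noteq> 0"
      using r'[OF len] not_less_Least by (metis of_bool_eq(2) zero_neq_one)
  qed
  then show ?thesis unfolding recfn_def by blast
qed

lemma computable_nat_iff_recfn: "computable_nat f \<longleftrightarrow> recfn 1 (\<lambda>xs. f (xs!0))"
proof -
  have "(\<forall>n. eval r [n] (f n)) \<longleftrightarrow> (\<forall>xs. length xs = 1 \<longrightarrow> eval r xs (f (xs!0)))" for r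
    by (auto simp: length_Suc_conv)
  then show ?thesis unfolding computable_nat_def recfn_def by simp
qed

section \<open>The pairing function and its inverse\<close>

lemma recfn_triangle: assumes "recfn k f" shows "recfn k (\<lambda>xs. triangle (f xs))"
proof -
  have "(\<Sum>j<n. Suc j) = triangle n" for n by (induction n) auto
  moreover have "recfn k (\<lambda>xs. \<Sum>j<f xs. Suc j)" by (intro recfn_intros assms) simp
  ultimately show ?thesis by simp
qed

lemma recfn_prod_encode [recfn_intros]:
  assumes "recfn k f" "recfn k g" shows "recfn k (\<lambda>xs. prod_encode (f xs, g xs))"
  unfolding prod_encode_def by (simp, intro recfn_intros recfn_triangle assms)

text \<open>Both components of a pair are at most its code, so exactly one term of the bounded
  double sum survives. This makes the projections recursive.\<close>

lemma sum_prod_decode: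
  fixes F :: "nat \<Rightarrow> nat \<Rightarrow> nat"
  shows "(\<Sum>a<Suc z. \<Sum>b<Suc z. of_bool (prod_encode (a,b) = z) * F a b)
     = F (fst (prod_decode z)) (snd (prod_decode z))"
proof -
  obtain a b where z: "z = prod_encode (a,b)" by (metis prod_decode_inverse surj_pair)
  have le: "a < Suc z" "b < Suc z" using z le_prod_encode_1 le_prod_encode_2 by (auto simp: less_Suc_eq_le)
  have "(\<Sum>b'<Suc z. of_bool (prod_encode (a',b') = z) * F a' b') = (if a' = a then F a b else 0)" for a'
  proof -
    have "(\<Sum>b'<Suc z. of_bool (prod_encode (a',b') = z) * F a' b') =
        (\<Sum>b'<Suc z. if b' = b then of_bool (a' = a) * F a b else 0)"
      by (rule sum.cong) (auto simp: z prod_encode_eq)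
    then show ?thesis using le by (simp add: sum.delta)
  qed
  then show ?thesis using le by (simp add: z sum.delta del: sum.lessThan_Suc)
qed

lemma recfn_fst_decode [recfn_intros]:
  assumes "recfn k f" shows "recfn k (\<lambda>xs. fst (prod_decode (f xs)))"
proof -
  have "recfn 1 (\<lambda>xs. \<Sum>a<Suc (xs!0). \<Sum>b<Suc (xs!0). of_bool (prod_encode (a,b) = xs!0) * a)"
    by (intro recfn_intros) simp_all
  then show ?thesis using recfn_comp1[OF _ assms, of "\<lambda>z. fst (prod_decode z)"]
    unfolding sum_prod_decode[where F = "\<lambda>a b. a"] by simp
qed

lemma recfn_snd_decode [recfn_intros]:
  assumes "recfn k f" shows "recfn k (\<lambda>xs. snd (prod_decode (f xs)))"
proof -
  have "recfn 1 (\<lambda>xs. \<Sum>a<Suc (xs!0). \<Sum>b<Suc (xs!0). of_bool (prod_encode (a,b) = xs!0) * b)"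
    by (intro recfn_intros) simp_all
  then show ?thesis using recfn_comp1[OF _ assms, of "\<lambda>z. snd (prod_decode z)"]
    unfolding sum_prod_decode[where F = "\<lambda>a b. b"] by simp
qed

section \<open>A universal machine\<close>

text \<open>The successor keeps 0 free for the empty list and the empty stack.\<close>

definition cell :: "nat \<Rightarrow> nat \<Rightarrow> nat" where "cell a b = Suc (prod_encode (a, b))"
definition car :: "nat \<Rightarrow> nat" where "car z = fst (prod_decode (z - 1))"
definition cdr :: "nat \<Rightarrow> nat" where "cdr z = snd (prod_decode (z - 1))"

lemma car_cell [simp]: "car (cell a b) = a"
  and cdr_cell [simp]: "cdr (cell a b) = b"
  and cell_neq_0 [simp]: "cell a b \<noteq> 0"
  by (simp_all add: car_def cdr_def cell_def)

lemma recfn_cell [recfn_intros]: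
  "recfn k f \<Longrightarrow> recfn k g \<Longrightarrow> recfn k (\<lambda>xs. cell (f xs) (g xs))"
  and recfn_car [recfn_intros]: "recfn k f \<Longrightarrow> recfn k (\<lambda>xs. car (f xs))"
  and recfn_cdr [recfn_intros]: "recfn k f \<Longrightarrow> recfn k (\<lambda>xs. cdr (f xs))"
  unfolding cell_def car_def cdr_def by (intro recfn_intros; assumption)+

definition lcode :: "nat list \<Rightarrow> nat" where "lcode xs = foldr cell xs 0"

lemma lcode_simps [simp]: "lcode [] = 0" "lcode (x # xs) = cell x (lcode xs)"
  by (simp_all add: lcode_def)

fun rcode :: "recf \<Rightarrow> nat" where
  "rcode Z = cell 0 0"
| "rcode S = cell 1 0"
| "rcode (Id i) = cell 2 i"
| "rcode (Cn f gs) = cell 3 (cell (rcode f) (lcode (map rcode gs)))"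
| "rcode (Pr f g) = cell 4 (cell (rcode f) (rcode g))"
| "rcode (Mn f) = cell 5 (rcode f)"

text \<open>
  States either evaluate the code \<open>r\<close> at the argument list \<open>xs\<close> or return a value \<open>y\<close> to the stack \<open>k\<close>.
  Tag 6, which is not the code of a function, evaluates a list of codes.  Tags of stack frames:
  0 remaining codes of a list, 1 value in front of a list, 2 outer function of a composition,
  3 primitive recursion, 4 minimisation.
\<close>

definition ev :: "nat \<Rightarrow> nat \<Rightarrow> nat \<Rightarrow> nat" where "ev r xs k = cell 0 (cell r (cell xs k))"
definition ret :: "nat \<Rightarrow> nat \<Rightarrow> nat" where "ret y k = cell 1 (cell y k)"

text \<open>Projections walk down the argument list one cell per step. Tags above 5 are all treated
  as the list tag 6, and the empty list of codes returns 0, which is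
  \<open>lcode []\<close>.\<close>

definition step_ev :: "nat \<Rightarrow> nat \<Rightarrow> nat \<Rightarrow> nat" where
  "step_ev r xs k =
    (if car r = 0 then ret 0 k
     else if car r = 1 then ret (Suc (car xs)) k
     else if car r = 2 then
       (if cdr r = 0 then ret (car xs) k else ev (cell 2 (cdr r - 1)) (cdr xs) k)
     else if car r = 3 then ev (cell 6 (cdr (cdr r))) xs (cell (cell 2 (car (cdr r))) k)
     else if car r = 4 then
       (if car xs = 0 then ev (car (cdr r)) (cdr xs) k
        else ev r (cell (car xs - 1) (cdr xs))
               (cell (cell 3 (cell (cdr (cdr r)) (cell (car xs - 1) (cdr xs)))) k))
     else if car r = 5 then ev (cdr r) (cell 0 xs) (cell (cell 4 (cell (cdr r) (cell 0 xs))) k)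
     else if cdr r = 0 then ret 0 k
     else ev (car (cdr r)) xs (cell (cell 0 (cell (cdr (cdr r)) xs)) k))"

definition step_ret :: "nat \<Rightarrow> nat \<Rightarrow> nat \<Rightarrow> nat" where
  "step_ret y fr k =
    (if car fr = 0 then ev (cell 6 (car (cdr fr))) (cdr (cdr fr)) (cell (cell 1 y) k)
     else if car fr = 1 then ret (cell (cdr fr) y) k
     else if car fr = 2 then ev (cdr fr) y k
     else if car fr = 3 then
       ev (car (cdr fr)) (cell (car (cdr (cdr fr))) (cell y (cdr (cdr (cdr fr))))) k
     else if y = 0 then ret (car (cdr (cdr fr))) k
     else ev (car (cdr fr)) (cell (Suc (car (cdr (cdr fr)))) (cdr (cdr (cdr fr))))
            (cell (cell 4 (cell (car (cdr fr))
               (cell (Suc (car (cdr (cdr fr)))) (cdr (cdr (cdr fr)))))) k))"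

definition step :: "nat \<Rightarrow> nat" where
  "step s =
    (if car s = 0 then step_ev (car (cdr s)) (car (cdr (cdr s))) (cdr (cdr (cdr s)))
     else if cdr (cdr s) = 0 then s
     else step_ret (car (cdr s)) (car (cdr (cdr s))) (cdr (cdr (cdr s))))"

lemma recfn_step [recfn_intros]:
  assumes "recfn k f" shows "recfn k (\<lambda>xs. step (f xs))"
proof -
  have "recfn 1 (\<lambda>xs. step (xs!0))"
    unfolding step_def step_ev_def step_ret_def ev_def ret_def by (intro recfn_intros) simp_all
  then show ?thesis using recfn_comp1[OF _ assms, of step] by simp
qed

lemma step_ev [simp]: "step (ev r xs k) = step_ev r xs k"
  by (simp add: step_def ev_def)

lemma step_ret [simp]: "step (ret y (cell fr k)) = step_ret y fr k"
  and step_halted [simp]: "step (ret y 0) = ret y 0"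
  by (simp_all add: step_def ret_def)

definition reaches :: "nat \<Rightarrow> nat \<Rightarrow> bool" where
  "reaches s s' \<longleftrightarrow> (\<exists>j. (step ^^ j) s = s')"

lemma reaches_refl: "reaches s s"
  unfolding reaches_def by (rule exI[of _ 0]) simp

lemma reaches_trans: "reaches s s' \<Longrightarrow> reaches s' s'' \<Longrightarrow> reaches s s''"
  unfolding reaches_def by (metis comp_apply funpow_add)

lemma reaches_step: "reaches (step s) s' \<Longrightarrow> reaches s s'"
  unfolding reaches_def by (metis comp_apply funpow_Suc_right)

lemma reaches_Id: "i < length xs \<Longrightarrow> reaches (ev (cell 2 i) (lcode xs) k) (ret (xs ! i) k)"
proof (induction i arbitrary: xs)
  case 0
  then obtain x ys where "xs = x # ys" by (cases xs) auto
  then show ?case by (rule_tac reaches_step) (simp add: step_ev_def reaches_refl)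
next
  case (Suc i)
  then obtain x ys where "xs = x # ys" by (cases xs) auto
  with Suc show ?case by (rule_tac reaches_step) (simp add: step_ev_def)
qed

lemma reaches_list:
  assumes "length ys = length gs"
    and "\<And>i k. i < length gs \<Longrightarrow> reaches (ev (rcode (gs ! i)) xs k) (ret (ys ! i) k)"
  shows "reaches (ev (cell 6 (lcode (map rcode gs))) xs k) (ret (lcode ys) k)"
  using assms
proof (induction gs arbitrary: ys k)
  case Nil
  then show ?case by (rule_tac reaches_step) (simp add: step_ev_def reaches_refl)
next
  case (Cons g gs)
  then obtain y ys' where ys: "ys = y # ys'" by (cases ys) auto
  have g: "reaches (ev (rcode g) xs k) (ret y k)" for k
    using Cons.prems(2)[of 0 k] ys by simp
  have gs: "reaches (ev (cell 6 (lcode (map rcode gs))) xs k) (ret (lcode ys') k)" for k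
  proof (rule Cons.IH)
    show "length ys' = length gs" using Cons.prems(1) ys by simp
    show "reaches (ev (rcode (gs ! i)) xs k) (ret (ys' ! i) k)" if "i < length gs" for i k
      using Cons.prems(2)[of "Suc i" k] that ys by simp
  qed
  show ?case
    apply (rule reaches_step, simp add: step_ev_def)
    apply (rule reaches_trans[OF g], rule reaches_step, simp add: step_ret_def)
    apply (rule reaches_trans[OF gs], rule reaches_step, simp add: step_ret_def ys)
    apply (rule reaches_refl)
    done
qed

text \<open>Induction from \<open>n\<close> downwards: when the frame of candidate \<open>m\<close>
  receives 0 it returns \<open>m\<close>, otherwise it starts the evaluation for
  \<open>Suc m\<close>.\<close>

lemma reaches_search:
  assumes zero: "\<And>k. reaches (ev r (cell n xs) k) (ret 0 k)"
    and pos: "\<And>m. m < n \<Longrightarrow> \<exists>y. y \<noteq> 0 \<and> (\<forall>k. reaches (ev r (cell m xs) k) (ret y k))"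
    and "m \<le> n"
  shows "reaches (ev r (cell m xs) (cell (cell 4 (cell r (cell m xs))) k)) (ret n k)"
  using \<open>m \<le> n\<close>
proof (induction m rule: inc_induct)
  case base
  show ?case
    by (rule reaches_trans[OF zero], rule reaches_step) (simp add: step_ret_def reaches_refl)
next
  case (step m)
  obtain y where "y \<noteq> 0" and y: "\<And>k. reaches (ev r (cell m xs) k) (ret y k)"
    using pos step.hyps by blast
  then show ?case
    by (rule_tac reaches_trans[OF y], rule_tac reaches_step) (simp add: step_ret_def step.IH)
qed

text \<open>The stack \<open>k\<close> is arbitrary because subcomputations run on top of the frames
  pushed by the enclosing one.\<close>

lemma eval_reaches:
  assumes "eval r xs y"
  shows "reaches (ev (rcode r) (lcode xs) k) (ret y k)"
  using assms
proof (induction arbitrary: k rule: eval.induct)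
  case (eval_Z xs)
  show ?case by (rule reaches_step) (simp add: step_ev_def reaches_refl)
next
  case (eval_S x xs)
  show ?case by (rule reaches_step) (simp add: step_ev_def reaches_refl)
next
  case (eval_Id i xs)
  then show ?case using reaches_Id by simp
next
  case (eval_Cn ys gs xs f y)
  have gs: "reaches (ev (cell 6 (lcode (map rcode gs))) (lcode xs) k) (ret (lcode ys) k)" for k
    by (rule reaches_list) (use eval_Cn in auto)
  show ?case
    apply (rule reaches_step, simp add: step_ev_def)
    apply (rule reaches_trans[OF gs], rule reaches_step, simp add: step_ret_def)
    apply (rule eval_Cn)
    done
next
  case (eval_Pr0 f xs y g)
  show ?case by (rule reaches_step) (simp add: step_ev_def eval_Pr0)
next
  case (eval_PrS f g n xs y z)
  show ?case
    apply (rule reaches_step, simp add: step_ev_def)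
    apply (rule reaches_trans[OF eval_PrS.IH(1)[simplified]], rule reaches_step)
    apply (use eval_PrS.IH(2) in \<open>simp add: step_ret_def\<close>)
    done
next
  case (eval_Mn f n xs)
  have "reaches (ev (rcode f) (cell 0 (lcode xs)) (cell (cell 4 (cell (rcode f) (cell 0 (lcode xs)))) k))
      (ret n k)"
    by (rule reaches_search) (use eval_Mn in auto)
  then show ?case by (rule_tac reaches_step) (simp add: step_ev_def)
qed

text \<open>0 means that no final state has been reached; \<open>Suc y\<close> stands for the output
  \<open>y\<close>.\<close>

definition outcome :: "nat \<Rightarrow> nat" where
  "outcome s = (if car s = 1 \<and> cdr (cdr s) = 0 then Suc (car (cdr s)) else 0)"

definition run :: "nat \<Rightarrow> nat \<Rightarrow> nat \<Rightarrow> nat" where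
  "run i n u = outcome ((step ^^ u) (ev i (cell n 0) 0))"

lemma recfn_run [recfn_intros]:
  assumes "recfn k f" "recfn k g" "recfn k h"
  shows "recfn k (\<lambda>xs. run (f xs) (g xs) (h xs))"
proof -
  have "rec_nat s (\<lambda>_ y. step y) u = (step ^^ u) s" for s u by (induction u) auto
  moreover have "recfn 3 (\<lambda>xs. rec_nat (ev (xs!0) (cell (xs!1) 0) 0) (\<lambda>_ y. step y) (xs!2))"
    unfolding ev_def by (intro recfn_rec_nat recfn_intros) simp_all
  ultimately have "recfn 3 (\<lambda>xs. (step ^^ (xs!2)) (ev (xs!0) (cell (xs!1) 0) 0))" by simp
  then have "recfn 3 (\<lambda>xs. run (xs!0) (xs!1) (xs!2))"
    unfolding run_def outcome_def by (intro recfn_intros)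
  then show ?thesis using recfn_comp3[of run] assms by blast
qed

lemma funpow_halted: "(step ^^ j) (ret y 0) = ret y 0"
  by (induction j) auto

lemma outcome_eq_Suc: "outcome s = Suc y \<Longrightarrow> step s = s"
  by (auto simp: outcome_def step_def split: if_splits)

text \<open>Final states are fixed points of \<open>step\<close>, so a run with nonzero outcome is
  already in the state that the simulation of \<open>eval\<close> reaches. Hence no other output can
  occur.\<close>

lemma run_complete:
  assumes r: "\<And>n. eval r [n] (s n)"
  shows "\<exists>u0. \<forall>u\<ge>u0. run (rcode r) n u = Suc (s n)"
    and "run (rcode r) n u = 0 \<or> run (rcode r) n u = Suc (s n)"
proof -
  define \<sigma> where "\<sigma> u = (step ^^ u) (ev (rcode r) (cell n 0) 0)" for u
  obtain j where j: "\<sigma> j = ret (s n) 0"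
    using eval_reaches[OF r[of n], of 0] by (auto simp: reaches_def \<sigma>_def)
  have \<sigma>_add: "\<sigma> (a + b) = (step ^^ a) (\<sigma> b)" for a b by (simp add: \<sigma>_def funpow_add)
  have late: "\<sigma> u = ret (s n) 0" if "u \<ge> j" for u
    using \<sigma>_add[of "u - j" j] that j by (simp add: funpow_halted)
  have out: "outcome (ret (s n) 0) = Suc (s n)" by (simp add: outcome_def ret_def)
  show "\<exists>u0. \<forall>u\<ge>u0. run (rcode r) n u = Suc (s n)"
    using late out by (intro exI[of _ j]) (simp add: run_def flip: \<sigma>_def)
  have "run (rcode r) n u = Suc (s n)" if nz: "run (rcode r) n u \<noteq> 0"
  proof -
    have fixed: "step (\<sigma> u) = \<sigma> u"
      using nz outcome_eq_Suc unfolding run_def \<sigma>_def by (metis not0_implies_Suc)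
    then have "(step ^^ a) (\<sigma> u) = \<sigma> u" for a by (induction a) auto
    then have "\<sigma> u = ret (s n) 0" using \<sigma>_add[of j u] late[of "j + u"] by simp
    then show ?thesis using out by (simp add: run_def flip: \<sigma>_def)
  qed
  then show "run (rcode r) n u = 0 \<or> run (rcode r) n u = Suc (s n)" by blast
qed

text \<open>Dovetailing: \<open>t\<close> codes an argument and a number of steps. A value counts
  only if it is at most \<open>Suc t\<close>, which gives \<open>seen_le\<close>; since
  \<open>run\<close> returns its successor, the test is against \<open>Suc (Suc t)\<close>.\<close>

primrec seen :: "nat \<Rightarrow> nat \<Rightarrow> nat" where
  "seen i 0 = 0"
| "seen i (Suc t) = max (seen i t)
     (if run i (fst (prod_decode t)) (snd (prod_decode t)) \<le> Suc (Suc t)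
      then run i (fst (prod_decode t)) (snd (prod_decode t)) - 1 else 0)"

lemma recfn_seen [recfn_intros]:
  assumes "recfn k f" "recfn k g"
  shows "recfn k (\<lambda>xs. seen (f xs) (g xs))"
proof -
  have "rec_nat 0 (\<lambda>t y. max y
     (if run i (fst (prod_decode t)) (snd (prod_decode t)) \<le> Suc (Suc t)
      then run i (fst (prod_decode t)) (snd (prod_decode t)) - 1 else 0)) t = seen i t" for i t
    by (induction t) auto
  moreover have "recfn 2 (\<lambda>xs. rec_nat 0 (\<lambda>t y. max y
     (if run (xs!0) (fst (prod_decode t)) (snd (prod_decode t)) \<le> Suc (Suc t)
      then run (xs!0) (fst (prod_decode t)) (snd (prod_decode t)) - 1 else 0)) (xs!1))"
    by (intro recfn_rec_nat recfn_intros) simp_all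
  ultimately show ?thesis using recfn_comp2[OF _ assms, of seen] by simp
qed

lemma seen_le: "seen i t \<le> t"
  by (induction t) auto

lemma seen_mono: "t \<le> u \<Longrightarrow> seen i t \<le> seen i u"
  by (rule lift_Suc_mono_le[of "seen i"]) auto

lemma seen_complete:
  assumes "computable_nat s" "strict_mono s"
  obtains i where "\<And>N. \<exists>t. seen i t \<ge> N" and "\<And>t. seen i t \<in> insert 0 (range s)"
proof -
  obtain r where r: "\<And>n. eval r [n] (s n)" using assms(1) unfolding computable_nat_def by blast
  show ?thesis
  proof
    fix N
    obtain u0 where u0: "\<And>u. u \<ge> u0 \<Longrightarrow> run (rcode r) N u = Suc (s N)"
      using run_complete(1)[OF r, of N] by blast
    \<comment> \<open>At least \<open>s N\<close> steps are granted, so that the code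
      \<open>t\<close> is at least \<open>s N\<close> too and the cap in \<open>seen\<close> lets
      this value through.\<close>
    define u where "u = max u0 (s N)"
    define t where "t = prod_encode (N, u)"
    have "s N \<le> t" using le_prod_encode_2[of u N] by (simp add: t_def u_def)
    then have "seen (rcode r) (Suc t) \<ge> s N"
      using u0[of u] by (simp add: t_def u_def)
    moreover have "N \<le> s N" by (rule strict_mono_imp_increasing[OF assms(2)])
    ultimately show "\<exists>t. seen (rcode r) t \<ge> N" using order_trans by blast
  next
    fix t
    show "seen (rcode r) t \<in> insert 0 (range s)"
    proof (induction t)
      case (Suc t)
      then show ?case
        using run_complete(2)[OF r, of "fst (prod_decode t)" "snd (prod_decode t)"]
        by (auto simp: max_def)
    qed simp
  qed
qed

section \<open>Gates\<close>

primrec table :: "(nat \<Rightarrow> nat) \<Rightarrow> nat \<Rightarrow> nat" where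
  "table g 0 = 0"
| "table g (Suc n) = cell (g n) (table g n)"

text \<open>A table has its last entry in front, so entry \<open>j\<close> of a table of length
  \<open>n\<close> lies behind \<open>n - Suc j\<close> tails.\<close>

definition lookup :: "nat \<Rightarrow> nat \<Rightarrow> nat \<Rightarrow> nat" where
  "lookup T n j = car ((cdr ^^ (n - Suc j)) T)"

lemma lookup_table: "j < n \<Longrightarrow> lookup (table g n) n j = g j"
proof -
  have "(cdr ^^ a) (table g (a + Suc j)) = table g (Suc j)" for a
    by (induction a) (simp_all add: funpow_Suc_right del: funpow.simps)
  from this[of "n - Suc j"] show "j < n \<Longrightarrow> ?thesis" by (simp add: lookup_def)
qed

lemma table_cong: "(\<And>i. i < n \<Longrightarrow> g i = g' i) \<Longrightarrow> table g n = table g' n"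
  by (induction n) auto

lemma recfn_lookup [recfn_intros]:
  assumes "recfn k f" "recfn k g" "recfn k h"
  shows "recfn k (\<lambda>xs. lookup (f xs) (g xs) (h xs))"
proof -
  have "rec_nat T (\<lambda>_ y. cdr y) u = (cdr ^^ u) T" for T u by (induction u) auto
  moreover have "recfn 3 (\<lambda>xs. car (rec_nat (xs!0) (\<lambda>_ y. cdr y) (xs!1 - Suc (xs!2))))"
    by (intro recfn_rec_nat recfn_intros) simp_all
  ultimately have "recfn 3 (\<lambda>xs. lookup (xs!0) (xs!1) (xs!2))"
    unfolding lookup_def by simp
  then show ?thesis using recfn_comp3[of lookup] assms by blast
qed

text \<open>An infinite array evolves in time, but by locality its cells up to \<open>i\<close>
  evolve on their own. It suffices to iterate a table of \<open>Suc i\<close> cells, whose front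
  entry is cell \<open>i\<close>.\<close>

lemma recfn_array_recursion:
  assumes A: "recfn 2 (\<lambda>xs. A (xs!0) (xs!1))"
    and G: "recfn 5 (\<lambda>xs. G (xs!0) (xs!1) (xs!2) (lookup (xs!3) (xs!4)))"
    and local: "\<And>p t i g g'. (\<And>j. j \<le> i \<Longrightarrow> g j = g' j) \<Longrightarrow> G p t i g = G p t i g'"
    and f0: "\<And>p i. f p 0 i = A p i"
    and fS: "\<And>p t i. f p (Suc t) i = G p t i (f p t)"
    and "recfn k a" "recfn k b" "recfn k c"
  shows "recfn k (\<lambda>xs. f (a xs) (b xs) (c xs))"
proof -
  have tab: "rec_nat 0 (\<lambda>i y. cell (h i) y) n = table h n" for h n
    by (induction n) auto
  have T: "rec_nat (table (A p) n) (\<lambda>t T. table (\<lambda>i. G p t i (lookup T n)) n) t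
      = table (f p t) n" for p n t
  proof (induction t)
    case 0
    show ?case by (auto intro: table_cong simp: f0)
  next
    case (Suc t)
    show ?case by (auto intro!: table_cong local simp: Suc fS lookup_table)
  qed
  define G' where "G' p t i T n = G p t i (lookup T n)" for p t i T n
  have G': "recfn 5 (\<lambda>xs. G' (xs!0) (xs!1) (xs!2) (xs!3) (xs!4))"
    using G by (simp add: G'_def)
  have "recfn 3 (\<lambda>xs. car (rec_nat (rec_nat 0 (\<lambda>i y. cell (A (xs!0) i) y) (Suc (xs!2)))
      (\<lambda>t T. rec_nat 0 (\<lambda>i y. cell (G' (xs!0) t i T (Suc (xs!2))) y) (Suc (xs!2))) (xs!1)))"
    by (intro recfn_rec_nat recfn_comp2[of A, OF A] recfn_comp5[of G', OF G'] recfn_intros) simp_all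
  then have "recfn 3 (\<lambda>xs. f (xs!0) (xs!1) (xs!2))"
    unfolding tab G'_def T by simp
  from recfn_comp3[of f, OF this assms(6-8)] show ?thesis .
qed

text \<open>
  A gate stores the number \<open>k\<close> of its ticks, the start \<open>b\<close> of the current interval (before the first
  tick: the row number), and the amount \<open>a / 2\<^sup>d\<close> that has passed during this interval.
\<close>

definition gate_state :: "nat \<Rightarrow> nat \<Rightarrow> nat \<Rightarrow> nat \<Rightarrow> nat" where
  "gate_state k b a d = cell k (cell b (cell a d))"

abbreviation "gk q \<equiv> car q"
abbreviation "gb q \<equiv> car (cdr q)"
abbreviation "ga q \<equiv> car (cdr (cdr q))"
abbreviation "gd q \<equiv> cdr (cdr (cdr q))"

text \<open>Together with \<open>flow_open\<close> this describes the flow into gate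
  \<open>i\<close> by integers: it is 2 to the power of minus \<open>flow_exp g i\<close> if every
  earlier gate is transparent or still open, and 0 otherwise.\<close>

definition flow_exp :: "(nat \<Rightarrow> nat) \<Rightarrow> nat \<Rightarrow> nat" where
  "flow_exp g i = (\<Sum>j<i. if gk (g j) = 0 then 0 else gb (g j))"

definition flow_open :: "(nat \<Rightarrow> nat) \<Rightarrow> nat \<Rightarrow> bool" where
  "flow_open g i \<longleftrightarrow> (\<forall>j<i. gk (g j) = 0 \<or> ga (g j) < 2 ^ gd (g j))"

text \<open>All gates are updated from the same state \<open>g\<close>. The last case adds the flow
  out of gate \<open>i\<close> to the stored fraction over a common denominator.\<close>

definition gate_step :: "nat \<Rightarrow> nat \<Rightarrow> nat \<Rightarrow> (nat \<Rightarrow> nat) \<Rightarrow> nat" where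
  "gate_step m t i g =
    (if gb (g i) \<le> seen i t \<and> (gk (g i) = 0 \<or> 2 ^ gd (g i) \<le> ga (g i))
     then gate_state (Suc (gk (g i))) (Suc t) 0 0
     else if gk (g i) = 0 \<or> \<not> flow_open g (Suc i) then g i
     else gate_state (gk (g i)) (gb (g i))
            (ga (g i) * 2 ^ flow_exp g (Suc i) + 2 ^ gd (g i)) (gd (g i) + flow_exp g (Suc i)))"

primrec gate :: "nat \<Rightarrow> nat \<Rightarrow> nat \<Rightarrow> nat" where
  "gate m 0 = (\<lambda>i. gate_state 0 m 0 0)"
| "gate m (Suc t) = (\<lambda>i. gate_step m t i (gate m t))"

lemma recfn_gate [recfn_intros]:
  assumes "recfn k a" "recfn k b" "recfn k c"
  shows "recfn k (\<lambda>xs. gate (a xs) (b xs) (c xs))"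
proof (rule recfn_array_recursion[where f = gate and A = "\<lambda>m i. gate_state 0 m 0 0" and G = gate_step])
  show "recfn 2 (\<lambda>xs. gate_state 0 (xs!0) 0 0)"
    unfolding gate_state_def by (intro recfn_intros) simp_all
  show "recfn 5 (\<lambda>xs. gate_step (xs!0) (xs!1) (xs!2) (lookup (xs!3) (xs!4)))"
    unfolding gate_step_def gate_state_def flow_exp_def flow_open_def
    by (intro recfn_intros) simp_all
  show "gate_step m t i g = gate_step m t i g'" if "\<And>j. j \<le> i \<Longrightarrow> g j = g' j" for m t i g g'
  proof -
    have "flow_exp g (Suc i) = flow_exp g' (Suc i)" "flow_open g (Suc i) = flow_open g' (Suc i)"
      using that by (auto simp: flow_exp_def flow_open_def less_Suc_eq_le intro!: sum.cong)
    then show ?thesis using that[of i] unfolding gate_step_def by (simp only: order_refl)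
  qed
qed (use assms in auto)

definition ticks :: "nat \<Rightarrow> nat \<Rightarrow> nat \<Rightarrow> nat" where
  "ticks m i t = gk (gate m t i)"

definition base :: "nat \<Rightarrow> nat \<Rightarrow> nat \<Rightarrow> nat" where
  "base m i t = gb (gate m t i)"

lemma recfn_ticks [recfn_intros]:
  assumes "recfn k a" "recfn k b" "recfn k c"
  shows "recfn k (\<lambda>xs. ticks (a xs) (b xs) (c xs))"
  unfolding ticks_def by (intro recfn_intros assms)

definition passed :: "nat \<Rightarrow> nat \<Rightarrow> nat \<Rightarrow> real" where
  "passed m i t = real (ga (gate m t i)) / 2 ^ gd (gate m t i)"

definition flow :: "nat \<Rightarrow> nat \<Rightarrow> nat \<Rightarrow> real" where
  "flow m i t = of_bool (flow_open (gate m t) i) / 2 ^ flow_exp (gate m t) i"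

definition tick :: "nat \<Rightarrow> nat \<Rightarrow> nat \<Rightarrow> bool" where
  "tick m i t \<longleftrightarrow> base m i t \<le> seen i t \<and> (ticks m i t = 0 \<or> passed m i t \<ge> 1)"

lemma pow2_le_real_iff: "(2 ^ d \<le> a) \<longleftrightarrow> 1 \<le> real a / 2 ^ d"
proof -
  have "2 ^ d \<le> a \<longleftrightarrow> real (2 ^ d) \<le> real a" by (simp only: of_nat_le_iff)
  then show ?thesis by simp
qed

text \<open>Turns the integer encoding, which makes the gates computable, into recurrences over the
  reals, on which their analysis rests.\<close>

lemma gate_simps [simp]:
  "ticks m i 0 = 0" "base m i 0 = m" "passed m i 0 = 0"
  "ticks m i (Suc t) = (if tick m i t then Suc (ticks m i t) else ticks m i t)"
  "base m i (Suc t) = (if tick m i t then Suc t else base m i t)"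
  "passed m i (Suc t) = (if tick m i t then 0 else
     if ticks m i t = 0 then passed m i t else passed m i t + flow m (Suc i) t)"
proof -
  have tick_iff: "tick m i t \<longleftrightarrow> base m i t \<le> seen i t \<and>
      (ticks m i t = 0 \<or> 2 ^ gd (gate m t i) \<le> ga (gate m t i))"
    unfolding tick_def passed_def pow2_le_real_iff ..
  show "ticks m i 0 = 0" "base m i 0 = m" "passed m i 0 = 0"
    by (simp_all add: gate_state_def passed_def ticks_def base_def)
  consider (tick) "tick m i t" | (idle) "\<not> tick m i t" "ticks m i t = 0 \<or> \<not> flow_open (gate m t) (Suc i)"
    | (pass) "\<not> tick m i t" "ticks m i t \<noteq> 0" "flow_open (gate m t) (Suc i)"
    by blast
  then have "ticks m i (Suc t) = (if tick m i t then Suc (ticks m i t) else ticks m i t) \<and>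
    base m i (Suc t) = (if tick m i t then Suc t else base m i t) \<and>
    passed m i (Suc t) = (if tick m i t then 0 else
     if ticks m i t = 0 then passed m i t else passed m i t + flow m (Suc i) t)"
  proof cases
    case tick
    then have "gate m (Suc t) i = gate_state (Suc (ticks m i t)) (Suc t) 0 0"
      by (simp add: gate_step_def tick_iff ticks_def base_def)
    with tick show ?thesis by (simp add: passed_def gate_state_def ticks_def base_def)
  next
    case idle
    then have "gate m (Suc t) i = gate m t i"
      by (auto simp: gate_step_def tick_iff ticks_def base_def)
    moreover have "flow m (Suc i) t = 0" if "ticks m i t \<noteq> 0"
      using idle that by (simp add: flow_def)
    ultimately show ?thesis using idle by (simp add: passed_def ticks_def base_def)
  next
    case pass
    then have "gate m (Suc t) i = gate_state (ticks m i t) (base m i t)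
        (ga (gate m t i) * 2 ^ flow_exp (gate m t) (Suc i) + 2 ^ gd (gate m t i))
        (gd (gate m t i) + flow_exp (gate m t) (Suc i))"
      by (auto simp: gate_step_def tick_iff ticks_def base_def)
    with pass show ?thesis
      by (simp add: passed_def gate_state_def flow_def power_add add_divide_distrib ticks_def base_def)
  qed
  then show "ticks m i (Suc t) = (if tick m i t then Suc (ticks m i t) else ticks m i t)"
    "base m i (Suc t) = (if tick m i t then Suc t else base m i t)"
    "passed m i (Suc t) = (if tick m i t then 0 else
     if ticks m i t = 0 then passed m i t else passed m i t + flow m (Suc i) t)"
    by blast+
qed

declare gate.simps [simp del]

lemma flow_0 [simp]: "flow m 0 t = 1"
  by (simp add: flow_def flow_open_def flow_exp_def)

lemma flow_Suc: "flow m (Suc i) t =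
  flow m i t * (if ticks m i t = 0 then 1 else if passed m i t < 1 then 1 / 2 ^ base m i t else 0)"
proof -
  have "passed m i t < 1 \<longleftrightarrow> ga (gate m t i) < 2 ^ gd (gate m t i)"
    unfolding passed_def by (metis not_le pow2_le_real_iff)
  then show ?thesis
    by (auto simp: flow_def flow_open_def flow_exp_def less_Suc_eq power_add ticks_def base_def)
qed

section \<open>Gains and the discarding of rows\<close>

definition moves :: "nat \<Rightarrow> nat \<Rightarrow> nat \<Rightarrow> bool" where
  "moves m e u \<longleftrightarrow> ticks m e u = 2 \<and> flow_open (gate m u) (Suc e)"

text \<open>The first argument of \<open>dead\<close> is a dummy that fits it to \<open>recfn_array_recursion\<close>.\<close>

primrec dead :: "nat \<Rightarrow> nat \<Rightarrow> nat \<Rightarrow> nat" where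
  "dead p 0 = (\<lambda>m. 0)"
| "dead p (Suc u) = (\<lambda>m. of_bool (dead p u m \<noteq> 0 \<or>
      (m \<le> u \<and> (\<exists>m'<m. dead p u m' = 0 \<and> (\<exists>e<Suc m'. moves m' e u)))))"

lemma recdec_moves [recfn_intros]:
  assumes "recfn k a" "recfn k b" "recfn k c"
  shows "recdec k (\<lambda>xs. moves (a xs) (b xs) (c xs))"
proof -
  have "recdec 3 (\<lambda>xs. moves (xs!0) (xs!1) (xs!2))"
    unfolding moves_def flow_open_def by (intro recfn_intros) simp_all
  then show ?thesis
    using recfn_comp3[of "\<lambda>x y z. of_bool (moves x y z)"] assms unfolding recdec_def by blast
qed

lemma recfn_dead [recfn_intros]:
  assumes "recfn k a" "recfn k b" "recfn k c"
  shows "recfn k (\<lambda>xs. dead (a xs) (b xs) (c xs))"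
proof (rule recfn_array_recursion[where f = dead and A = "\<lambda>p i. 0" and G = "\<lambda>p u m g. of_bool (g m \<noteq> 0 \<or>
      (m \<le> u \<and> (\<exists>m'<m. g m' = 0 \<and> (\<exists>e<Suc m'. moves m' e u))))"])
  show "recfn 5 (\<lambda>xs. of_bool (lookup (xs!3) (xs!4) (xs!2) \<noteq> 0 \<or>
      (xs!2 \<le> xs!1 \<and> (\<exists>m'<xs!2. lookup (xs!3) (xs!4) m' = 0 \<and> (\<exists>e<Suc m'. moves m' e (xs!1))))))"
    by (intro recfn_intros) simp_all
qed (use assms in \<open>auto intro: recfn_const\<close>)

definition live :: "nat \<Rightarrow> nat \<Rightarrow> bool" where "live m u \<longleftrightarrow> dead 0 u m = 0"

definition acts :: "nat \<Rightarrow> nat \<Rightarrow> bool" where "acts m u \<longleftrightarrow> live m u \<and> (\<exists>e\<le>m. moves m e u)"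

lemma live_0 [simp]: "live m 0" by (simp add: live_def)

lemma live_Suc: "live m (Suc u) \<longleftrightarrow> live m u \<and> (u < m \<or> (\<forall>m'<m. \<not> acts m' u))"
  unfolding live_def acts_def
  by (simp only: dead.simps of_bool_eq_0_iff less_Suc_eq_le de_Morgan_disj not_not not_less[symmetric])
    blast

lemma recdec_live [recfn_intros]:
  assumes "recfn k a" "recfn k b" shows "recdec k (\<lambda>xs. live (a xs) (b xs))"
  unfolding live_def by (intro recfn_intros assms)

text \<open>The counter is 2 during the second interval. The first tick only needs an element \<ge>
  \<open>m\<close>; the second needs one that is not below the start of the first interval, hence a
  further value of an enumerated sequence.\<close>

definition gain :: "nat \<Rightarrow> nat \<Rightarrow> nat \<Rightarrow> real" where
  "gain m e u = of_bool (ticks m e u = 2) * flow m (Suc e) u"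

definition rises :: "nat \<Rightarrow> nat \<Rightarrow> nat \<Rightarrow> bool" where
  "rises m e u \<longleftrightarrow> live m u \<and> moves m e u"

lemma recdec_rises [recfn_intros]:
  assumes "recfn k a" "recfn k b" "recfn k c"
  shows "recdec k (\<lambda>xs. rises (a xs) (b xs) (c xs))"
  unfolding rises_def by (intro recfn_intros assms)

section \<open>The computable approximation\<close>

definition approx_num :: "nat \<Rightarrow> nat" where
  "approx_num t = (\<Sum>u<t. \<Sum>m<Suc u. \<Sum>e<Suc m. of_bool (rises m e u) *
      2 ^ (t * t + 3 * t - (flow_exp (gate m u) (Suc e) + 3 * Suc m)))"

definition approx_den :: "nat \<Rightarrow> nat" where "approx_den t = t * t + 3 * t"

definition contrib :: "nat \<Rightarrow> nat \<Rightarrow> real" where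
  "contrib m u = of_bool (live m u) * (\<Sum>e<Suc m. gain m e u) / 8 ^ Suc m"

definition approx :: "nat \<Rightarrow> real" where
  "approx t = (\<Sum>u<t. \<Sum>m<Suc u. contrib m u)"

lemma computable_approx_num: "computable_nat approx_num" and computable_approx_den: "computable_nat approx_den"
  unfolding computable_nat_iff_recfn approx_num_def approx_den_def flow_exp_def
  by (intro recfn_intros; simp)+

lemma base_le: "ticks m i t \<noteq> 0 \<Longrightarrow> base m i t \<le> t"
  by (induction t) (auto split: if_splits)

text \<open>At stages before \<open>t\<close> a term involves at most \<open>t\<close> gates, each
  damping by an exponent below \<open>t\<close>, and its weight adds at most \<open>3 * t\<close> to
  the exponent. So the subtraction in the exponent is exact.\<close>

lemma approx_eq: "approx t = real (approx_num t) / 2 ^ approx_den t"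
proof -
  have *: "of_bool (live m u) * gain m e u / 8 ^ Suc m =
      of_bool (rises m e u) * 2 ^ (t * t + 3 * t - (flow_exp (gate m u) (Suc e) + 3 * Suc m))
        / 2 ^ approx_den t" if "u < t" "m < Suc u" "e < Suc m" for u m e
  proof -
    have "flow_exp (gate m u) (Suc e) \<le> (\<Sum>j<Suc e. u)"
      unfolding flow_exp_def by (intro sum_mono) (auto intro: base_le[unfolded base_def ticks_def])
    also have "\<dots> \<le> t * t" using that by (simp del: mult_Suc add: mult_le_mono)
    finally have "flow_exp (gate m u) (Suc e) + 3 * Suc m \<le> t * t + 3 * t" using that by simp
    moreover have "(8::real) ^ Suc m = 2 ^ (3 * Suc m)" by (simp only: power_mult) simp
    ultimately show ?thesis
      by (auto simp: approx_den_def gain_def flow_def rises_def moves_def power_diff power_add field_simps)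
  qed
  have "approx t = (\<Sum>u<t. \<Sum>m<Suc u. \<Sum>e<Suc m. of_bool (live m u) * gain m e u / 8 ^ Suc m)"
    unfolding approx_def contrib_def by (simp only: sum_distrib_left sum_divide_distrib)
  also have "\<dots> = (\<Sum>u<t. \<Sum>m<Suc u. \<Sum>e<Suc m.
      of_bool (rises m e u) * 2 ^ (t * t + 3 * t - (flow_exp (gate m u) (Suc e) + 3 * Suc m))
        / 2 ^ approx_den t)"
    by (intro sum.cong refl *) auto
  also have "\<dots> = real (approx_num t) / 2 ^ approx_den t"
    unfolding approx_num_def by (simp only: sum_divide_distrib of_nat_sum of_nat_mult of_nat_power of_nat_of_bool of_nat_numeral)
  finally show ?thesis .
qed

definition approx_rat :: "nat \<Rightarrow> rat" where
  "approx_rat t = of_nat (approx_num t) / 2 ^ approx_den t"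

lemma real_of_approx_rat: "real_of_rat (approx_rat t) = approx t"
  by (simp add: approx_rat_def approx_eq of_rat_divide of_rat_power)

lemma computable_approx_rat: "computable_rat_seq approx_rat"
proof -
  have "computable_nat (\<lambda>t. 0)" "computable_nat (\<lambda>t. 2 ^ approx_den t - 1)"
    using computable_approx_den unfolding computable_nat_iff_recfn by (intro recfn_intros; simp)+
  moreover have "approx_rat t = (of_nat (approx_num t) - of_nat 0) / of_nat (Suc (2 ^ approx_den t - 1))" for t
    by (simp add: approx_rat_def)
  ultimately show ?thesis unfolding computable_rat_seq_def using computable_approx_num by blast
qed

section \<open>Flow through the gates\<close>

lemma flow_bounds: "0 \<le> flow m i t" "flow m i t \<le> 1"
  by (simp_all add: flow_def field_simps)

lemma flow_Suc_le: "flow m (Suc i) t \<le> flow m i t"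
  using flow_bounds[of m i t] by (auto simp: flow_Suc mult_left_le)

lemma flow_antimono: "i \<le> j \<Longrightarrow> flow m j t \<le> flow m i t"
  by (rule lift_Suc_antimono_le[of "\<lambda>i. flow m i t"]) (auto intro: flow_Suc_le)

lemma flow_Suc_closed: "ticks m i t \<noteq> 0 \<Longrightarrow> passed m i t \<ge> 1 \<Longrightarrow> flow m (Suc i) t = 0"
  by (simp add: flow_Suc)

lemma ticks_mono: "t \<le> u \<Longrightarrow> ticks m i t \<le> ticks m i u"
  by (rule lift_Suc_mono_le[of "\<lambda>t. ticks m i t"]) auto

text \<open>A gate closes once 1 is reached, and one stage adds at most 1.\<close>

lemma passed_bounds: "0 \<le> passed m i t" "passed m i t \<le> 2"
proof -
  show "0 \<le> passed m i t" by (simp add: passed_def)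
  show "passed m i t \<le> 2"
  proof (induction t)
    case (Suc t)
    then show ?case
      using flow_Suc_closed[of m i t] flow_bounds[of m "Suc i" t] by (cases "passed m i t < 1") auto
  qed simp
qed

definition inflow :: "nat \<Rightarrow> nat \<Rightarrow> nat \<Rightarrow> real" where
  "inflow m i t = (\<Sum>u<t. flow m i u)"

lemma inflow_Suc [simp]: "inflow m i (Suc t) = inflow m i t + flow m i t"
  by (simp add: inflow_def)

lemma inflow_mono: "t \<le> u \<Longrightarrow> inflow m i t \<le> inflow m i u"
  by (rule lift_Suc_mono_le[of "inflow m i"]) (auto simp: flow_bounds)

text \<open>As long as the gate is open, everything since the start of the interval has been damped
  by the same factor.\<close>

lemma passed_eq_inflow:
  assumes "ticks m i t \<noteq> 0" "passed m i t < 1"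
  shows "passed m i t = (inflow m i t - inflow m i (base m i t)) / 2 ^ base m i t"
  using assms
proof (induction t)
  case (Suc t)
  show ?case
  proof (cases "tick m i t")
    case False
    with Suc.prems have "ticks m i t \<noteq> 0" "passed m i t < 1"
      using flow_bounds(1)[of m "Suc i" t] by (auto split: if_splits)
    with Suc False show ?thesis by (simp add: flow_Suc diff_divide_distrib add_divide_distrib)
  qed simp
qed simp

lemma inflow_eq_passed:
  assumes "ticks m i t \<noteq> 0"
  shows "inflow m (Suc i) t = inflow m (Suc i) (base m i t) + passed m i t"
  using assms by (induction t) auto

lemma no_tick_const:
  assumes "\<forall>u\<ge>t. \<not> tick m i u" "u \<ge> t"
  shows "ticks m i u = ticks m i t" "base m i u = base m i t"
    "passed m i t \<le> passed m i u"
  using assms(2)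
  by (induction u rule: dec_induct) (use assms(1) flow_bounds(1) in \<open>auto intro: add_increasing2\<close>)

section \<open>Unbounded flow\<close>

definition unbounded :: "(nat \<Rightarrow> real) \<Rightarrow> bool" where
  "unbounded f \<longleftrightarrow> (\<forall>c. \<exists>t. f t \<ge> c)"

text \<open>Until 1 has passed there is no tick, so the start \<open>b\<close> of the interval stays
  fixed and an inflow of \<open>2 ^ b\<close> suffices.\<close>

lemma passed_reaches_1:
  assumes unb: "unbounded (inflow m i)" and nz: "ticks m i t \<noteq> 0"
  shows "\<exists>u\<ge>t. passed m i u \<ge> 1"
proof (rule ccontr)
  assume "\<not> ?thesis"
  then have lt: "passed m i u < 1" if "u \<ge> t" for u using that by (meson not_le)
  have nz': "ticks m i u \<noteq> 0" if "u \<ge> t" for u using ticks_mono[OF that, of m i] nz by linarith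
  have "\<forall>u\<ge>t. \<not> tick m i u" using lt nz' by (auto simp: tick_def not_le)
  note const = no_tick_const[OF this]
  define b where "b = base m i t"
  obtain v where v: "inflow m i v \<ge> inflow m i b + 2 ^ b" using unb unfolding unbounded_def by blast
  define u where "u = max t v"
  have u: "u \<ge> t" "inflow m i u \<ge> inflow m i b + 2 ^ b"
    using v inflow_mono[of v u m i] by (auto simp: u_def)
  have "passed m i u = (inflow m i u - inflow m i b) / 2 ^ b"
    using passed_eq_inflow[OF nz' lt, OF u(1) u(1)] const(2)[OF u(1)] by (simp add: b_def)
  also have "\<dots> \<ge> 1" using u(2) by (simp add: le_divide_eq)
  finally show False using lt[OF u(1)] by simp
qed

lemma exists_tick:
  assumes unb: "unbounded (inflow m i)" and seen: "\<And>N. \<exists>t. seen i t \<ge> N"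
  shows "\<exists>u\<ge>t. tick m i u"
proof (rule ccontr)
  assume "\<not> ?thesis"
  then have "\<forall>u\<ge>t. \<not> tick m i u" by blast
  note none = this and const = no_tick_const[OF this]
  obtain t' where t': "t' \<ge> t" "ticks m i t = 0 \<or> passed m i t' \<ge> 1"
    using passed_reaches_1[OF unb, of t] by (cases "ticks m i t = 0") auto
  obtain v where v: "seen i v \<ge> base m i t" using seen by blast
  define u where "u = max t' v"
  have u: "u \<ge> t" "u \<ge> t'" using t' by (auto simp: u_def)
  have "seen i u \<ge> base m i u" using const(2)[OF u(1)] v seen_mono[of v u i] by (simp add: u_def)
  moreover have "passed m i t' \<le> passed m i u"
    by (rule no_tick_const(3)[OF _ u(2)]) (use none t'(1) in auto)
  then have "ticks m i u = 0 \<or> passed m i u \<ge> 1"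
    using t'(2) const(1)[OF u(1)] by auto
  ultimately have "tick m i u" by (simp add: tick_def)
  then show False using none u(1) by blast
qed

lemma ticks_unbounded:
  assumes "\<And>t. \<exists>u\<ge>t. tick m i u"
  shows "\<exists>t. ticks m i t \<ge> N"
proof (induction N)
  case (Suc N)
  then obtain t where t: "ticks m i t \<ge> N" by blast
  obtain u where "u \<ge> t" "tick m i u" using assms by blast
  then have "ticks m i (Suc u) \<ge> Suc N" using t ticks_mono[of t u m i] by simp
  then show ?case by blast
qed simp

text \<open>Every completed interval lets at least 1 pass. Of the intervals that start after
  \<open>t0\<close> only the last need not be complete, hence the slack 1.\<close>

lemma ticks_le_inflow:
  assumes "t0 \<le> t" "ticks m i t0 < ticks m i t"
  shows "real (ticks m i t) \<le> ticks m i t0 + 1 + (inflow m (Suc i) t - inflow m (Suc i) t0)"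
proof -
  \<comment> \<open>For the induction the inflow is counted only up to the start of the current
    interval.\<close>
  have "ticks m i t0 < ticks m i t \<longrightarrow>
    real (ticks m i t) \<le> ticks m i t0 + 1 + (inflow m (Suc i) (base m i t) - inflow m (Suc i) t0)"
    using assms(1)
  proof (induction t rule: dec_induct)
    case (step t)
    show ?case
    proof (cases "tick m i t \<and> ticks m i t0 < ticks m i t")
      case True
      then have "ticks m i t \<noteq> 0" "passed m i t \<ge> 1" by (auto simp: tick_def)
      then have "inflow m (Suc i) t \<ge> inflow m (Suc i) (base m i t) + 1"
        using inflow_eq_passed[of m i t] by linarith
      moreover have "inflow m (Suc i) (Suc t) \<ge> inflow m (Suc i) t" by (simp add: flow_bounds)
      ultimately show ?thesis using step.IH True by auto
    next
      case False
      have "inflow m (Suc i) (Suc t) \<ge> inflow m (Suc i) t0"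
        using step.hyps by (intro inflow_mono) auto
      then show ?thesis using False step.IH ticks_mono[OF step.hyps(1), of m i] by auto
    qed
  qed simp
  moreover have "inflow m (Suc i) (base m i t) \<le> inflow m (Suc i) t"
    using assms by (intro inflow_mono base_le) auto
  ultimately show ?thesis using assms(2) by linarith
qed

lemma unbounded_inflow_Suc:
  assumes "\<And>t. \<exists>u\<ge>t. tick m i u"
  shows "unbounded (inflow m (Suc i))"
  unfolding unbounded_def
proof
  fix c :: real
  obtain t where t: "ticks m i t \<ge> nat \<lceil>c\<rceil> + 2" using ticks_unbounded[OF assms] by blast
  then have "real (ticks m i t) \<ge> c + 2" by linarith
  moreover have "real (ticks m i t) \<le> 1 + inflow m (Suc i) t"
    using ticks_le_inflow[of 0 t m i] t by (simp add: inflow_def)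
  ultimately show "\<exists>t. c \<le> inflow m (Suc i) t" by (intro exI[of _ t]) linarith
qed

text \<open>A gate with unbounded inflow either ticks for ever, passing at least 1 per interval, or
  ticks no more; then it has always been transparent or it closes for good.\<close>

lemma flow_dichotomy: "unbounded (inflow m i) \<or> (\<exists>T. \<forall>u\<ge>T. flow m i u = 0)"
proof (induction i)
  case 0
  have "inflow m 0 t = real t" for t by (simp add: inflow_def)
  then show ?case by (simp add: unbounded_def) (metis real_arch_simple)
next
  case (Suc i)
  consider (zero) T where "\<forall>u\<ge>T. flow m i u = 0"
    | (often) "\<And>t. \<exists>u\<ge>t. tick m i u"
    | (stop) t where "unbounded (inflow m i)" "\<forall>u\<ge>t. \<not> tick m i u"
    using Suc by blast
  then show ?case
  proof cases
    case zero
    then show ?thesis by (auto simp: flow_Suc)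
  next
    case often
    then show ?thesis using unbounded_inflow_Suc by blast
  next
    case stop
    note const = no_tick_const[OF stop(2)]
    show ?thesis
    proof (cases "ticks m i t = 0")
      case True
      have "ticks m i u = 0" for u
        using const(1)[of u] ticks_mono[of u t m i] True by (cases "u \<ge> t") auto
      then have "inflow m (Suc i) = inflow m i" by (simp add: inflow_def flow_Suc fun_eq_iff)
      then show ?thesis using stop(1) by simp
    next
      case False
      then obtain T where T: "T \<ge> t" "passed m i T \<ge> 1" using passed_reaches_1[OF stop(1)] by blast
      have "flow m (Suc i) u = 0" if "u \<ge> T" for u
      proof (rule flow_Suc_closed)
        show "ticks m i u \<noteq> 0" using const(1)[of u] T(1) that False by simp
        have "passed m i T \<le> passed m i u"
          by (rule no_tick_const(3)[OF _ that]) (use T(1) stop(2) in auto)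
        then show "passed m i u \<ge> 1" using T(2) by simp
      qed
      then show ?thesis by blast
    qed
  qed
qed

lemma ticks_eq_0:
  assumes "\<And>t. seen i t < m" shows "ticks m i t = 0"
proof -
  have "ticks m i t = 0 \<and> base m i t = m"
  proof (induction t)
    case (Suc t)
    then have "\<not> tick m i t" using assms[of t] by (simp add: tick_def)
    with Suc show ?case by simp
  qed simp
  then show ?thesis by blast
qed

text \<open>In late rows a program with bounded output leaves its gate transparent, and the gates of
  the other programs tick for ever. So the flow stays unbounded behind any fixed number of
  gates.\<close>

lemma eventually_unbounded:
  "\<exists>M. \<forall>m\<ge>M. (\<forall>i\<le>j. unbounded (inflow m i)) \<and>
      (\<forall>i<j. (\<forall>N. \<exists>t. seen i t \<ge> N) \<or> (\<forall>t. ticks m i t = 0))"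
proof (induction j)
  case 0
  have "inflow m 0 t = real t" for m t by (simp add: inflow_def)
  then have "unbounded (inflow m 0)" for m by (simp add: unbounded_def) (metis real_arch_simple)
  then show ?case by simp
next
  case (Suc j)
  then obtain M where M: "\<And>m. m \<ge> M \<Longrightarrow> (\<forall>i\<le>j. unbounded (inflow m i)) \<and>
      (\<forall>i<j. (\<forall>N. \<exists>t. seen i t \<ge> N) \<or> (\<forall>t. ticks m i t = 0))" by blast
  show ?case
  proof (cases "\<forall>N. \<exists>t. seen j t \<ge> N")
    case True
    have "unbounded (inflow m (Suc j))" if "m \<ge> M" for m
      using exists_tick[of m j] M[OF that] True by (intro unbounded_inflow_Suc) blast
    then show ?thesis using M True by (intro exI[of _ M]) (auto simp: le_Suc_eq less_Suc_eq)
  next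
    case False
    then obtain N where N: "\<And>t. seen j t < N" by (auto simp: not_le)
    have tz: "ticks m j t = 0" if "m \<ge> N" for m t
      by (rule ticks_eq_0) (use N that less_le_trans in blast)
    have "unbounded (inflow m (Suc j))" if "m \<ge> M" "m \<ge> N" for m
    proof -
      have "inflow m (Suc j) = inflow m j" using tz[OF that(2)] by (simp add: inflow_def flow_Suc fun_eq_iff)
      then show ?thesis using M[OF that(1)] by simp
    qed
    then show ?thesis using M tz by (intro exI[of _ "max M N"]) (auto simp: le_Suc_eq less_Suc_eq)
  qed
qed

section \<open>Gains of a gate and surviving rows\<close>

lemma gain_bounds: "0 \<le> gain m e u" "gain m e u \<le> flow m (Suc e) u"
  by (auto simp: gain_def flow_bounds)

lemma moves_iff_gain: "moves m e u \<longleftrightarrow> gain m e u \<noteq> 0"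
  by (auto simp: moves_def gain_def flow_def)

text \<open>The accumulated gain equals \<open>passed\<close> during the second interval and is
  frozen afterwards; that interval can only end once 1 has passed.\<close>

lemma sum_gain:
  shows "(\<Sum>u<t. gain m e u) \<le> 2"
    and "ticks m e t > 2 \<Longrightarrow> (\<Sum>u<t. gain m e u) \<ge> 1"
proof -
  have "(ticks m e t < 2 \<longrightarrow> (\<Sum>u<t. gain m e u) = 0) \<and>
    (ticks m e t = 2 \<longrightarrow> (\<Sum>u<t. gain m e u) = passed m e t) \<and>
    (ticks m e t > 2 \<longrightarrow> 1 \<le> (\<Sum>u<t. gain m e u)) \<and> (\<Sum>u<t. gain m e u) \<le> 2"
  proof (induction t)
    case (Suc t)
    show ?case
    proof (cases "ticks m e t = 2 \<and> tick m e t")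
      case True
      then have "passed m e t \<ge> 1" by (auto simp: tick_def)
      then have "gain m e t = 0" using True flow_Suc_closed[of m e t] by (simp add: gain_def)
      then show ?thesis using Suc True \<open>passed m e t \<ge> 1\<close> by simp
    next
      case False
      show ?thesis
      proof (cases "ticks m e t = 2")
        case True
        then have "(\<Sum>u<Suc t. gain m e u) = passed m e (Suc t)"
          using Suc False by (simp add: gain_def)
        then show ?thesis using True False passed_bounds(2)[of m e "Suc t"] by (simp del: gate_simps(6))
      next
        case not2: False
        then have "gain m e t = 0" by (simp add: gain_def)
        then show ?thesis using Suc not2 by auto
      qed
    qed
  qed simp
  then show "(\<Sum>u<t. gain m e u) \<le> 2"
    "ticks m e t > 2 \<Longrightarrow> (\<Sum>u<t. gain m e u) \<ge> 1" by blast+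
qed

text \<open>The critical case is a gate that stays in its second interval for ever: its outflow is
  bounded, so by \<open>flow_dichotomy\<close> it eventually vanishes.\<close>

lemma gain_eventually_0: "\<exists>T. \<forall>u\<ge>T. gain m e u = 0"
proof -
  consider (gt) t where "ticks m e t > 2" | (ne) "\<And>t. ticks m e t \<noteq> 2"
    | (eq) t where "ticks m e t = 2" "\<And>u. ticks m e u \<le> 2"
    by (meson not_le)
  then show ?thesis
  proof cases
    case gt
    have "gain m e u = 0" if "u \<ge> t" for u
      using ticks_mono[OF that, of m e] gt by (simp add: gain_def)
    then show ?thesis by blast
  next
    case ne
    then show ?thesis by (simp add: gain_def)
  next
    case eq
    have two: "ticks m e u = 2" if "u \<ge> t" for u
      using ticks_mono[OF that, of m e] eq(1) eq(2)[of u] by simp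
    have no: "\<forall>u\<ge>t. \<not> tick m e u"
    proof (intro allI impI notI)
      fix u assume "t \<le> u" "tick m e u"
      then have "ticks m e (Suc u) = 3" using two by simp
      then show False using eq(2)[of "Suc u"] by simp
    qed
    have "inflow m (Suc e) u \<le> inflow m (Suc e) (base m e t) + 2" if "u \<ge> t" for u
      using inflow_eq_passed[of m e u] two[OF that] no_tick_const(2)[OF no that] passed_bounds(2)[of m e u]
      by simp
    then have bd: "inflow m (Suc e) u \<le> inflow m (Suc e) (base m e t) + 2" for u
      using inflow_mono[of u "max u t" m "Suc e"] by (meson max.cobounded1 max.cobounded2 order_trans)
    have "\<not> unbounded (inflow m (Suc e))"
      unfolding unbounded_def not_all not_ex not_le
      by (intro exI[of _ "inflow m (Suc e) (base m e t) + 3"] allI le_less_trans[OF bd]) simp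
    then obtain T where "\<forall>u\<ge>T. flow m (Suc e) u = 0" using flow_dichotomy by blast
    then show ?thesis by (auto simp: gain_def)
  qed
qed

lemma row_eventually_0: "\<exists>T. \<forall>u\<ge>T. \<forall>e\<le>m. gain m' e u = 0"
proof (induction m)
  case 0
  then show ?case using gain_eventually_0[of m' 0] by simp
next
  case (Suc m)
  then obtain T where "\<forall>u\<ge>T. \<forall>e\<le>m. gain m' e u = 0" by blast
  moreover obtain T' where "\<forall>u\<ge>T'. gain m' (Suc m) u = 0" using gain_eventually_0 by blast
  ultimately show ?case by (intro exI[of _ "max T T'"]) (auto simp: le_Suc_eq)
qed

text \<open>A finite injury argument. Let \<open>m\<close> be the least row that acts at or after
  stage \<open>N\<close>, and \<open>t\<close> the last stage at which it acts. The rows between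
  \<open>m\<close> and \<open>t\<close> are then discarded and rows below \<open>m\<close> do not
  act any more, so nothing can discard row \<open>Suc t\<close>.\<close>

lemma exists_live_forever: "\<exists>m>N. \<forall>u. live m u"
proof -
  have live: "\<forall>u. live m u" if "\<And>u m'. u \<ge> m \<Longrightarrow> m' < m \<Longrightarrow> \<not> acts m' u" for m
  proof
    show "live m u" for u
    proof (induction u)
      case (Suc u)
      then show ?case using that[of u] by (auto simp: live_Suc not_less)
    qed simp
  qed
  show ?thesis
  proof (cases "\<exists>m u. u \<ge> N \<and> acts m u")
    case False
    then have "\<forall>u. live (Suc N) u" by (intro live) auto
    then show ?thesis by blast
  next
    case True
    define m where "m = (LEAST m. \<exists>u\<ge>N. acts m u)"
    have m: "\<exists>u\<ge>N. acts m u" unfolding m_def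
      by (rule LeastI_ex[of "\<lambda>m. \<exists>u\<ge>N. acts m u"]) (use True in blast)
    have least: "\<not> acts m' u" if "m' < m" "u \<ge> N" for m' u
      using that not_less_Least[of m' "\<lambda>m. \<exists>u\<ge>N. acts m u"] by (auto simp: m_def)
    obtain T where "\<forall>u\<ge>T. \<forall>e\<le>m. gain m e u = 0" using row_eventually_0 by blast
    then have "\<not> acts m u" if "u \<ge> T" for u
      using that by (auto simp: acts_def moves_iff_gain)
    then have "{u. u \<ge> N \<and> acts m u} \<subseteq> {..<T}" by (auto simp: not_le[symmetric])
    then have fin: "finite {u. u \<ge> N \<and> acts m u}" by (rule finite_subset) simp
    define t where "t = Max {u. u \<ge> N \<and> acts m u}"
    have "t \<in> {u. u \<ge> N \<and> acts m u}" unfolding t_def using m fin by (intro Max_in) auto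
    then have t: "t \<ge> N" "acts m t" by auto
    have last: "\<not> acts m u" if "u > t" for u
    proof
      assume "acts m u"
      then have "u \<le> t" unfolding t_def using fin that t(1) by (intro Max_ge) auto
      then show False using that by simp
    qed
    have "\<not> acts m' u" if "u \<ge> Suc t" "m' < Suc t" for u m'
    proof -
      have "\<not> live m' u" if "m < m'"
      proof -
        have "\<not> live m' (Suc t)" using t(2) \<open>m < m'\<close> \<open>m' < Suc t\<close> by (auto simp: live_Suc)
        with \<open>u \<ge> Suc t\<close> show ?thesis
          by (induction u rule: dec_induct) (simp_all add: live_Suc)
      qed
      moreover have "\<not> acts m' u" if "m' < m" using least[OF that, of u] \<open>u \<ge> Suc t\<close> t(1) by simp
      moreover have "\<not> acts m u" using last[of u] \<open>u \<ge> Suc t\<close> by simp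
      ultimately show ?thesis by (metis acts_def linorder_neqE_nat)
    qed
    then have "\<forall>u. live (Suc t) u" by (intro live) auto
    then show ?thesis using t(1) by (intro exI[of _ "Suc t"]) auto
  qed
qed

section \<open>The limit\<close>

lemma contrib_nonneg: "0 \<le> contrib m u"
  unfolding contrib_def by (intro divide_nonneg_nonneg mult_nonneg_nonneg sum_nonneg gain_bounds) auto

lemma contrib_le: "contrib m u \<le> (\<Sum>e<Suc m. gain m e u) / 8 ^ Suc m"
  unfolding contrib_def
  by (intro divide_right_mono mult_left_le_one_le sum_nonneg gain_bounds) auto

lemma approx_diff: "a \<le> b \<Longrightarrow> approx b - approx a = (\<Sum>u\<in>{a..<b}. \<Sum>m<Suc u. contrib m u)"
  unfolding approx_def lessThan_atLeast0
  using sum.atLeastLessThan_concat[of 0 a b "\<lambda>u. \<Sum>m\<in>{0..<Suc u}. contrib m u"] by simp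

lemma approx_mono: "a \<le> b \<Longrightarrow> approx a \<le> approx b"
proof -
  have "0 \<le> (\<Sum>u\<in>{a..<b}. \<Sum>m<Suc u. contrib m u)" by (intro sum_nonneg contrib_nonneg)
  then show "a \<le> b \<Longrightarrow> ?thesis" using approx_diff[of a b] by linarith
qed

lemma approx_diff_le:
  assumes "a \<le> b"
  shows "approx b - approx a \<le> (\<Sum>m<b. \<Sum>u\<in>{a..<b}. contrib m u)"
proof -
  have "approx b - approx a \<le> (\<Sum>u\<in>{a..<b}. \<Sum>m<b. contrib m u)"
    unfolding approx_diff[OF assms] by (intro sum_mono sum_mono2) (auto simp: contrib_nonneg)
  then show ?thesis by (subst sum.swap)
qed

lemma sum_contrib_le_gain:
  "(\<Sum>u\<in>A. contrib m u) \<le> (\<Sum>e<Suc m. \<Sum>u\<in>A. gain m e u) / 8 ^ Suc m"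
proof -
  have "(\<Sum>u\<in>A. contrib m u) \<le> (\<Sum>u\<in>A. (\<Sum>e<Suc m. gain m e u) / 8 ^ Suc m)"
    by (intro sum_mono contrib_le)
  also have "\<dots> = (\<Sum>e<Suc m. \<Sum>u\<in>A. gain m e u) / 8 ^ Suc m"
    by (subst sum.swap) (simp only: sum_divide_distrib)
  finally show ?thesis .
qed

text \<open>Row \<open>m\<close> uses \<open>Suc m\<close> \<le> \<open>2 ^ m\<close> gates, so the
  weight with base 8 leaves a geometric bound with ratio 2/8.\<close>

lemma sum_contrib_le_bound:
  assumes "\<And>e. e \<le> m \<Longrightarrow> (\<Sum>u\<in>A. gain m e u) \<le> 2 * c" "0 \<le> c"
  shows "(\<Sum>u\<in>A. contrib m u) \<le> c * (1/4) ^ Suc m"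
proof -
  have "Suc m \<le> 2 ^ m" by (induction m) auto
  then have "real (Suc m) \<le> real (2 ^ m)" by (simp only: of_nat_le_iff)
  then have *: "real (Suc m) * (2 * c) \<le> 2 ^ Suc m * c"
    using mult_right_mono[of "real (Suc m)" "2 ^ m" "2 * c"] assms(2) by simp
  have "(\<Sum>u\<in>A. contrib m u) \<le> (\<Sum>e<Suc m. 2 * c) / 8 ^ Suc m"
    using assms(1) by (intro order_trans[OF sum_contrib_le_gain] divide_right_mono sum_mono) auto
  also have "\<dots> \<le> 2 ^ Suc m * c / 8 ^ Suc m"
    using * by (intro divide_right_mono) auto
  also have "\<dots> = c * (2 / 8) ^ Suc m" by (simp only: power_divide) simp
  finally show ?thesis by simp
qed

lemma sum_contrib_le: "(\<Sum>u\<in>{a..<b}. contrib m u) \<le> (1/4) ^ Suc m"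
proof -
  have "(\<Sum>u\<in>{a..<b}. gain m e u) \<le> 2 * 1" for e
  proof -
    have "(\<Sum>u\<in>{a..<b}. gain m e u) \<le> (\<Sum>u<b. gain m e u)"
      by (intro sum_mono2) (auto simp: gain_bounds)
    then show ?thesis using sum_gain(1)[of m e b] by simp
  qed
  from sum_contrib_le_bound[of m "{a..<b}" 1, OF this] show ?thesis by simp
qed

lemma geometric_tail_le: "(\<Sum>m\<in>{T..<b}. (1/4) ^ Suc m) \<le> (1/4::real) ^ T / 3"
proof (cases "T \<le> b")
  case True
  define r :: real where "r = 1/4"
  have "(\<Sum>m\<in>{T..<b}. r ^ Suc m) = (r ^ T - r ^ b) / 3" using True
  proof (induction b rule: dec_induct)
    case (step b)
    have "r ^ Suc b = r ^ b / 4" by (simp add: r_def)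
    with step show ?case by (simp del: power_Suc add: field_simps)
  qed simp
  moreover have "0 \<le> r ^ b" by (simp add: r_def)
  ultimately have "(\<Sum>m\<in>{T..<b}. r ^ Suc m) \<le> r ^ T / 3" by (simp del: power_Suc)
  then show ?thesis by (simp only: r_def)
qed simp

lemma approx_bounded: "approx b \<le> 1 / 3"
proof -
  have "approx b - approx 0 \<le> (\<Sum>m<b. \<Sum>u\<in>{0..<b}. contrib m u)" by (intro approx_diff_le) simp
  also have "\<dots> \<le> (\<Sum>m\<in>{0..<b}. (1/4) ^ Suc m)"
    unfolding lessThan_atLeast0 by (intro sum_mono sum_contrib_le)
  also have "\<dots> \<le> (1/4) ^ 0 / 3" by (rule geometric_tail_le)
  finally show ?thesis by (simp add: approx_def)
qed

section \<open>Convergence and regaining approximability\<close>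

definition approx_lim :: real where "approx_lim = lim approx"

lemma approx_tendsto: "approx \<longlonglongrightarrow> approx_lim"
proof -
  have "incseq approx" using approx_mono by (simp add: incseq_def)
  then obtain l where "approx \<longlonglongrightarrow> l" using incseq_convergent[of approx "1/3"] approx_bounded by blast
  then show ?thesis by (simp add: approx_lim_def limI)
qed

lemma approx_le_approx_lim: "approx t \<le> approx_lim"
  using approx_tendsto approx_mono by (intro incseq_le) (auto simp: incseq_def)

lemma approx_lim_diff_le:
  assumes "\<And>b. b \<ge> a \<Longrightarrow> approx b - approx a \<le> c"
  shows "approx_lim - approx a \<le> c"
proof -
  have "approx_lim \<le> c + approx a"
    by (rule LIMSEQ_le_const2[OF approx_tendsto]) (use assms in \<open>auto simp: algebra_simps\<close>)
  then show ?thesis by simp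
qed

text \<open>If row \<open>m\<close> is never discarded, no smaller row acts from stage
  \<open>m\<close> on, so only the geometric tail of the rows from \<open>m\<close> on
  remains.\<close>

lemma approx_lim_diff_live:
  assumes "\<forall>u. live m u"
  shows "approx_lim - approx m < (1/2) ^ m"
proof -
  have "approx b - approx m \<le> (1/4) ^ m / 3" if "b \<ge> m" for b
  proof -
    have zero: "contrib m' u = 0" if "m' < m" "u \<ge> m" for m' u
    proof -
      have "\<not> acts m' u" using assms that live_Suc[of m u] by auto
      then have "\<not> live m' u \<or> (\<forall>e\<le>m'. gain m' e u = 0)" by (auto simp: acts_def moves_iff_gain)
      then show ?thesis by (auto simp: contrib_def less_Suc_eq_le simp del: sum.lessThan_Suc)
    qed
    have "approx b - approx m \<le> (\<Sum>m'<b. \<Sum>u\<in>{m..<b}. contrib m' u)" by (rule approx_diff_le[OF that])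
    also have "\<dots> = (\<Sum>m'\<in>{m..<b}. \<Sum>u\<in>{m..<b}. contrib m' u)"
      by (rule sum.mono_neutral_right) (auto simp: zero)
    also have "\<dots> \<le> (\<Sum>m'\<in>{m..<b}. (1/4) ^ Suc m')" by (intro sum_mono sum_contrib_le)
    also have "\<dots> \<le> (1/4) ^ m / 3" by (rule geometric_tail_le)
    finally show ?thesis .
  qed
  then have "approx_lim - approx m \<le> (1/4) ^ m / 3" by (rule approx_lim_diff_le)
  also have "\<dots> < (1/4) ^ m" by simp
  also have "\<dots> \<le> (1/2) ^ m" by (intro power_mono) auto
  finally show ?thesis .
qed

lemma regainingly_approximable_approx_lim: "regainingly_approximable approx_lim"
  unfolding regainingly_approximable_def
proof (intro exI[of _ approx_rat] conjI)
  show "computable_rat_seq approx_rat" by (rule computable_approx_rat)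
  show "mono approx_rat"
  proof
    fix a b :: nat assume "a \<le> b"
    then have "real_of_rat (approx_rat a) \<le> real_of_rat (approx_rat b)" using approx_mono by (simp add: real_of_approx_rat)
    then show "approx_rat a \<le> approx_rat b" by (simp add: of_rat_less_eq)
  qed
  show "(\<lambda>n. real_of_rat (approx_rat n)) \<longlonglongrightarrow> approx_lim" using approx_tendsto by (simp add: real_of_approx_rat)
  have "\<exists>n>N. n \<in> {n. approx_lim - real_of_rat (approx_rat n) < (1/2) ^ n}" for N
    using exists_live_forever[of N] approx_lim_diff_live by (auto simp: real_of_approx_rat)
  then show "infinite {n. approx_lim - real_of_rat (approx_rat n) < (1/2) ^ n}"
    unfolding finite_nat_set_iff_bounded by (metis less_asym)
qed

section \<open>Non-computability of the limit\<close>

lemma approx_approximation_search: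
  assumes "computable_real approx_lim"
  obtains f where "computable_nat f" "\<And>m. approx_lim - approx (f m) < 1 / 8 ^ Suc m"
proof -
  obtain q where q: "computable_rat_seq q" "\<And>n. \<bar>approx_lim - real_of_rat (q n)\<bar> < (1/2) ^ n"
    using assms unfolding computable_real_def by blast
  obtain a b c where abc: "computable_nat a" "computable_nat b" "computable_nat c"
    and q_eq: "\<And>n. q n = (of_nat (a n) - of_nat (b n)) / of_nat (Suc (c n))"
    using q(1) unfolding computable_rat_seq_def by blast
  \<comment> \<open>Comparison of the approximation with \<open>q n\<close> minus the error bound,
    with denominators cleared and negative terms moved across so that it is decidable over the
    naturals.\<close>
  define P where "P t n \<longleftrightarrow>
      a n * 2 ^ approx_den t * 2 ^ n <
      approx_num t * Suc (c n) * 2 ^ n + b n * 2 ^ approx_den t * 2 ^ n + 2 ^ approx_den t * Suc (c n)" for t n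
  have P_iff: "P t n \<longleftrightarrow> real_of_rat (q n) - (1/2) ^ n < approx t" for t n
  proof -
    have "P t n \<longleftrightarrow> real (a n * 2 ^ approx_den t * 2 ^ n) <
      real (approx_num t * Suc (c n) * 2 ^ n + b n * 2 ^ approx_den t * 2 ^ n + 2 ^ approx_den t * Suc (c n))"
      unfolding P_def by (simp only: of_nat_less_iff)
    also have "\<dots> \<longleftrightarrow> (real (a n) - real (b n)) / real (Suc (c n)) - (1/2) ^ n < real (approx_num t) / 2 ^ approx_den t"
    proof -
      have "((A - B) / C - 1 / N < X / D) \<longleftrightarrow> (A * D * N < X * C * N + B * D * N + D * C)"
        if "C > 0" "N > 0" "D > 0" for A B C D N X :: real
        using that by (simp add: field_simps)
      from this[of "real (Suc (c n))" "2 ^ n" "2 ^ approx_den t" "real (a n)" "real (b n)" "real (approx_num t)"]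
      show ?thesis
        by (simp only: of_nat_add of_nat_mult of_nat_power of_nat_numeral power_one_over zero_less_power
            zero_less_numeral of_nat_0_less_iff zero_less_Suc)
    qed
    also have "\<dots> \<longleftrightarrow> real_of_rat (q n) - (1/2) ^ n < approx t"
      by (simp only: q_eq approx_eq of_rat_divide of_rat_diff of_rat_of_nat_eq)
    finally show ?thesis .
  qed
  have ex: "\<exists>t. P t n" for n
  proof -
    have "real_of_rat (q n) - (1/2) ^ n < approx_lim" using q(2)[of n] by linarith
    then have "eventually (\<lambda>t. real_of_rat (q n) - (1/2) ^ n < approx t) sequentially"
      using approx_tendsto by (rule order_tendstoD(1)[rotated])
    then show ?thesis unfolding P_iff eventually_sequentially by blast
  qed
  \<comment> \<open>Both the error of \<open>q\<close> and the slack in \<open>P\<close> cost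
    \<open>(1/2) ^ (3 * m + 5)\<close>; their sum is half of \<open>1 / 8 ^ Suc m\<close>.\<close>
  define f where "f m = (LEAST t. P t (3 * m + 5))" for m
  show thesis
  proof
    have cl: "recfn k (\<lambda>xs. a (h xs))" "recfn k (\<lambda>xs. b (h xs))" "recfn k (\<lambda>xs. c (h xs))"
      "recfn k (\<lambda>xs. approx_num (h xs))" "recfn k (\<lambda>xs. approx_den (h xs))" if "recfn k h" for h k
      using recfn_comp1[OF _ that] abc computable_approx_num computable_approx_den
      unfolding computable_nat_iff_recfn by blast+
    have "recfn 1 (\<lambda>xs. LEAST t. P t (3 * xs!0 + 5))"
    proof (rule recfn_Least)
      show "recdec (Suc 1) (\<lambda>zs. P (zs!0) (3 * drop 1 zs ! 0 + 5))"
        unfolding P_def by (intro recfn_intros cl) simp_all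
    qed (rule ex)
    then show "computable_nat f" unfolding computable_nat_iff_recfn f_def .
    fix m
    have "P (f m) (3 * m + 5)" unfolding f_def using ex by (rule LeastI_ex)
    then have "approx_lim - approx (f m) < 2 * (1/2) ^ (3 * m + 5)"
      using q(2)[of "3 * m + 5"] unfolding P_iff by linarith
    also have "\<dots> = (1/2) * (1/8) ^ Suc m"
      by (simp add: power_add power_mult power_divide)
    also have "\<dots> < (1/8) ^ Suc m" by simp
    also have "\<dots> = 1 / 8 ^ Suc m" by (simp only: power_one_over)
    finally show "approx_lim - approx (f m) < 1 / 8 ^ Suc m" .
  qed
qed

lemma not_computable_approx_lim: "\<not> computable_real approx_lim"
proof
  assume "computable_real approx_lim"
  then obtain f where f: "computable_nat f" "\<And>m. approx_lim - approx (f m) < 1 / 8 ^ Suc m"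
    using approx_approximation_search by blast
  define s where "s n = rec_nat 0 (\<lambda>_ y. Suc (max y (f y))) n" for n
  have s_Suc: "s (Suc n) = Suc (max (s n) (f (s n)))" for n by (simp add: s_def)
  have "strict_mono s" by (simp add: strict_mono_Suc_iff s_Suc less_Suc_eq_le)
  moreover have "computable_nat s"
    unfolding computable_nat_iff_recfn s_def
    by (intro recfn_rec_nat recfn_intros recfn_comp1[OF f(1)[unfolded computable_nat_iff_recfn]]) simp_all
  ultimately obtain e where e: "\<And>N. \<exists>t. seen e t \<ge> N" "\<And>t. seen e t \<in> insert 0 (range s)"
    using seen_complete by blast
  \<comment> \<open>Starting at 0 makes the initial value of \<open>seen\<close> a value of
    \<open>s\<close> as well.\<close>
  have "s 0 = 0" by (simp add: s_def)
  then have seen_s: "seen e t \<in> range s" for t using e(2)[of t] by (metis insertE rangeI)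
  obtain M where M: "\<And>m. m \<ge> M \<Longrightarrow> unbounded (inflow m e)"
    using eventually_unbounded[of e] by blast
  obtain m where m: "m > max M e" "\<forall>u. live m u" using exists_live_forever by blast
  have ticking: "\<exists>u\<ge>t. tick m e u" for t using exists_tick[OF M e(1)] m(1) by simp
  have late: "\<exists>n. m \<le> s n \<and> f (s n) \<le> u" if two: "ticks m e u = 2" for u
  proof -
    \<comment> \<open>The first tick is caused by a value \<open>s n\<close> \<ge> \<open>m\<close>
      that is at most the stage, hence below the start of the new interval. The second tick then
      requires a value beyond \<open>s n\<close>, so stage \<open>s (Suc n)\<close> has been
      reached.\<close>
    have one: "(ticks m e u = 1 \<longrightarrow> (\<exists>n. m \<le> s n \<and> s n < base m e u)) \<and>
      (ticks m e u = 0 \<longrightarrow> base m e u = m)" for u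
    proof (induction u)
      case (Suc u)
      obtain n where "seen e u = s n" using seen_s[of u] by blast
      then show ?case using Suc seen_le[of e u] by (auto simp: tick_def)
    qed simp
    have "ticks m e u = 2 \<longrightarrow> (\<exists>n. m \<le> s n \<and> s (Suc n) \<le> u)"
    proof (induction u)
      case (Suc u)
      show ?case
      proof (cases "ticks m e u = 1 \<and> tick m e u")
        case True
        then obtain n where n: "m \<le> s n" "s n < base m e u" using one[of u] by auto
        obtain n' where n': "seen e u = s n'" using seen_s[of u] by blast
        have "s n < s n'" using n(2) True n' by (simp add: tick_def)
        then have "Suc n \<le> n'" using \<open>strict_mono s\<close> by (simp add: strict_mono_less Suc_le_eq)
        then have "s (Suc n) \<le> s n'" using \<open>strict_mono s\<close> by (simp add: strict_mono_less_eq)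
        then have "s (Suc n) \<le> Suc u" using n' seen_le[of e u] by simp
        then show ?thesis using n(1) by blast
      next
        case False
        then show ?thesis using Suc by (auto simp: le_SucI)
      qed
    qed simp
    then obtain n where "m \<le> s n" "s (Suc n) \<le> u" using two by blast
    then show ?thesis by (intro exI[of _ n]) (simp add: s_Suc)
  qed
  obtain t where t: "ticks m e t \<ge> 3" using ticks_unbounded[OF ticking] by blast
  have "\<exists>u. ticks m e u = 2"
  proof -
    have "ticks m e v \<ge> 2 \<longrightarrow> (\<exists>u. ticks m e u = 2)" for v
    proof (induction v)
      case (Suc v)
      show ?case
      proof (cases "ticks m e (Suc v) = 2")
        case False
        then have "2 \<le> ticks m e (Suc v) \<longrightarrow> 2 \<le> ticks m e v" by auto
        then show ?thesis using Suc by blast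
      qed blast
    qed simp
    from this[of t] t show ?thesis by simp
  qed
  define u0 where "u0 = (LEAST u. ticks m e u = 2)"
  have u0: "ticks m e u0 = 2" unfolding u0_def using \<open>\<exists>u. ticks m e u = 2\<close> by (rule LeastI_ex)
  have u0_le: "u0 \<le> u" if "ticks m e u = 2" for u unfolding u0_def using that by (rule Least_le)
  obtain n where n: "m \<le> s n" "f (s n) \<le> u0" using late[OF u0] by blast
  \<comment> \<open>Needed because row \<open>m\<close> enters the approximation only from stage
    \<open>m\<close> on. Before that stage nothing \<ge> \<open>m\<close> can have been
    seen.\<close>
  have "m \<le> u0"
  proof -
    have "ticks m e u = 0 \<and> base m e u = m" if "u \<le> m" for u
      using that
    proof (induction u)
      case (Suc u)
      then have "\<not> tick m e u" using seen_le[of e u] by (simp add: tick_def)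
      with Suc show ?case by simp
    qed simp
    from this[of u0] u0 show ?thesis by fastforce
  qed
  have "u0 \<le> t"
    using ticks_mono[of t u0 m e] u0 t by (cases "u0 \<le> t") auto
  \<comment> \<open>The whole gain of the gate, at least 1, comes at or after \<open>u0\<close> and
    thus after the modulus claims that less than the weight of row \<open>m\<close> is
    missing.\<close>
  have "1 \<le> (\<Sum>u<t. gain m e u)" using sum_gain(2)[of m e t] t by simp
  also have "\<dots> = (\<Sum>u\<in>{u0..<t}. gain m e u)"
    using u0_le by (intro sum.mono_neutral_right) (auto simp: gain_def)
  finally have gain1: "1 \<le> (\<Sum>u\<in>{u0..<t}. gain m e u)" .
  have "1 / 8 ^ Suc m \<le> (\<Sum>u\<in>{u0..<t}. gain m e u) / 8 ^ Suc m"
    using gain1 by (intro divide_right_mono) auto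
  also have "\<dots> = (\<Sum>u\<in>{u0..<t}. gain m e u / 8 ^ Suc m)" by (simp only: sum_divide_distrib)
  also have "\<dots> \<le> (\<Sum>u\<in>{u0..<t}. contrib m u)"
  proof (intro sum_mono)
    fix u
    have "gain m e u \<le> (\<Sum>e<Suc m. gain m e u)"
      using m(1) by (intro member_le_sum) (auto simp: gain_bounds)
    then show "gain m e u / 8 ^ Suc m \<le> contrib m u"
      using m(2) unfolding contrib_def by (simp add: divide_right_mono del: sum.lessThan_Suc)
  qed
  also have "\<dots> \<le> (\<Sum>u\<in>{u0..<t}. \<Sum>m<Suc u. contrib m u)"
    using \<open>m \<le> u0\<close> by (intro sum_mono member_le_sum) (auto simp: contrib_nonneg)
  also have "\<dots> = approx t - approx u0" using approx_diff[OF \<open>u0 \<le> t\<close>] by simp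
  also have "\<dots> \<le> approx_lim - approx (f (s n))" using approx_le_approx_lim[of t] approx_mono[OF n(2)] by linarith
  also have "\<dots> < 1 / 8 ^ Suc (s n)" by (rule f(2))
  also have "\<dots> \<le> 1 / 8 ^ Suc m" using n(1) by (intro divide_left_mono power_increasing) auto
  finally show False by simp
qed

section \<open>Near computability\<close>

lemma gain_le_flow:
  assumes "i < e" "k \<le> t" "t \<le> u"
    and big: "inflow m (Suc i) k + 2 ^ k \<le> inflow m (Suc i) t"
  shows "gain m e u \<le> flow m (Suc i) u / 2 ^ k"
proof (cases "ticks m e u = 2")
  case False
  then show ?thesis by (simp add: gain_def flow_bounds)
next
  case True
  \<comment> \<open>The first gate above \<open>i\<close> that is not transparent at
    \<open>u\<close>. Everything that passes gate \<open>i\<close> reaches it undamped, and no more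
    can pass gate \<open>e\<close> than passes gate \<open>j\<close>.\<close>
  define j where "j = (LEAST j. i < j \<and> ticks m j u \<noteq> 0)"
  have j: "i < j \<and> ticks m j u \<noteq> 0" unfolding j_def
    by (rule LeastI[of "\<lambda>j. i < j \<and> ticks m j u \<noteq> 0" e]) (use assms True in auto)
  have "j \<le> e" unfolding j_def
    by (rule Least_le) (use assms True in auto)
  have below: "ticks m j' v = 0" if "i < j'" "j' < j" "v \<le> u" for j' v
  proof -
    have "ticks m j' u = 0" using that not_less_Least[of j' "\<lambda>j. i < j \<and> ticks m j u \<noteq> 0"]
      by (auto simp: j_def)
    then show ?thesis using ticks_mono[OF that(3), of m j'] by simp
  qed
  have flow_eq: "flow m j v = flow m (Suc i) v" if "v \<le> u" for v
  proof -
    have "flow m j' v = flow m (Suc i) v" if "Suc i \<le> j'" "j' \<le> j" for j'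
      using that
    proof (induction j' rule: dec_induct)
      case (step j')
      then show ?case using below[of j' v] \<open>v \<le> u\<close> by (simp add: flow_Suc)
    qed simp
    from this[of j] j show ?thesis by simp
  qed
  have inflow_eq: "inflow m j v = inflow m (Suc i) v" if "v \<le> u" for v
    unfolding inflow_def using that flow_eq by (intro sum.cong) auto
  have "gain m e u \<le> flow m (Suc e) u" by (rule gain_bounds)
  also have "\<dots> \<le> flow m (Suc j) u" using \<open>j \<le> e\<close> by (intro flow_antimono) simp
  also have "\<dots> \<le> flow m (Suc i) u / 2 ^ k"
  proof (cases "passed m j u < 1")
    case False
    then show ?thesis using j by (simp add: flow_Suc flow_bounds)
  next
    case lt: True
    \<comment> \<open>Had the interval started before \<open>k\<close>, the gate would have received
      at least \<open>2 ^ k\<close> since then, which is enough to close it. So it damps by at least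
      this factor.\<close>
    have "k \<le> base m j u"
    proof (rule ccontr)
      assume "\<not> k \<le> base m j u"
      then have b: "base m j u \<le> k" by simp
      have "inflow m j (base m j u) \<le> inflow m j k" by (rule inflow_mono[OF b])
      then have "inflow m j u - inflow m j (base m j u) \<ge> 2 ^ k"
        using big inflow_mono[OF assms(3), of m "Suc i"] inflow_eq[of u] inflow_eq[of k] assms by simp
      moreover have "(2::real) ^ k \<ge> 2 ^ base m j u" using b by (intro power_increasing) auto
      ultimately have "inflow m j u - inflow m j (base m j u) \<ge> 2 ^ base m j u" by linarith
      then have "passed m j u \<ge> 1"
        using passed_eq_inflow[of m j u] j lt by (simp add: le_divide_eq)
      then show False using lt by simp
    qed
    then have "flow m j u / 2 ^ base m j u \<le> flow m j u / 2 ^ k"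
      by (intro divide_left_mono power_increasing) (auto simp: flow_bounds)
    then show ?thesis using lt j flow_eq[of u] by (simp add: flow_Suc)
  qed
  finally show ?thesis .
qed

text \<open>To tick, a gate must have seen a value of \<open>s\<close> that is not below its previous tick; hence it
  ticks at most once between consecutive values of \<open>s\<close>.\<close>

lemma flow_between_values:
  assumes s: "strict_mono s" "\<And>t. seen i t \<in> insert 0 (range s)"
    and nz: "ticks m i (s n) \<noteq> 0"
  shows "(\<Sum>u\<in>{s n..<s (Suc n)}. flow m (Suc i) u) \<le> 4"
proof -
  define a where "a = s n"
  \<comment> \<open>In the first alternative there was no tick since \<open>a\<close>; in the second
    there was one, and the interval it ended contributed at most 2.\<close>
  have inv: "(base m i u \<le> a \<and>
        inflow m (Suc i) u = inflow m (Suc i) a + passed m i u - passed m i a) \<or>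
      (base m i u > a \<and> inflow m (Suc i) u \<le> inflow m (Suc i) a + 2 + passed m i u)"
    if "a \<le> u" "u \<le> s (Suc n)" for u
    using that
  proof (induction u rule: dec_induct)
    case base
    show ?case using base_le[of m i a] nz by (simp add: a_def)
  next
    case (step u)
    have nz': "ticks m i u \<noteq> 0" using ticks_mono[of a u m i] nz step.hyps by (simp add: a_def)
    show ?case
    proof (cases "tick m i u")
      case False
      then show ?thesis using step nz' by auto
    next
      case True
      \<comment> \<open>Seen values are at most the stage \<open>u\<close>, and below
        \<open>s (Suc n)\<close> there is no value of \<open>s\<close> beyond
        \<open>s n\<close>.\<close>
      have "seen i u \<le> a"
      proof (cases "seen i u = 0")
        case False
        then obtain n' where n': "seen i u = s n'" using s(2)[of u] by auto
        then have "s n' < s (Suc n)" using seen_le[of i u] step.prems by simp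
        then have "n' \<le> n" using s(1) by (simp add: strict_mono_less)
        then show ?thesis using n' s(1) by (simp add: a_def strict_mono_less_eq)
      qed simp
      then have "base m i u \<le> a" using True by (simp add: tick_def)
      then have "inflow m (Suc i) u = inflow m (Suc i) a + passed m i u - passed m i a"
        using step by auto
      moreover have "flow m (Suc i) u = 0" using True nz' by (intro flow_Suc_closed) (auto simp: tick_def)
      ultimately show ?thesis
        using True step.hyps passed_bounds(2)[of m i u] passed_bounds(1)[of m i a] by simp
    qed
  qed
  have le: "s n \<le> s (Suc n)" using s(1) by (simp add: strict_mono_less_eq)
  have "(\<Sum>u\<in>{s n..<s (Suc n)}. flow m (Suc i) u) = inflow m (Suc i) (s (Suc n)) - inflow m (Suc i) a"
    unfolding inflow_def lessThan_atLeast0 a_def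
    using sum.atLeastLessThan_concat[of 0 "s n" "s (Suc n)" "flow m (Suc i)"] le by simp
  also have "\<dots> \<le> 4"
    using inv[of "s (Suc n)"] le passed_bounds[of m i "s (Suc n)"] passed_bounds[of m i a]
    by (auto simp: a_def)
  finally show ?thesis .
qed

lemma converges_nearly_computably_approx: "converges_nearly_computably_to approx approx_lim"
  unfolding converges_nearly_computably_to_def
proof (intro conjI allI impI)
  show "approx \<longlonglongrightarrow> approx_lim" by (rule approx_tendsto)
  fix s assume s: "computable_nat s \<and> strict_mono s"
  then obtain i where i: "\<And>N. \<exists>t. seen i t \<ge> N" "\<And>t. seen i t \<in> insert 0 (range s)"
    using seen_complete by blast
  \<comment> \<open>From row \<open>M\<close> on, the gates up to \<open>i\<close> outside
    \<open>E\<close> are transparent for ever, so only those in \<open>E\<close> can gain.\<close>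
  define E where "E = {e. e \<le> i \<and> (\<forall>N. \<exists>t. seen e t \<ge> N)}"
  have finE: "finite E" by (rule finite_subset[of _ "{..i}"]) (auto simp: E_def)
  obtain M where M': "\<And>m. m \<ge> M \<Longrightarrow> (\<forall>e\<le>Suc i. unbounded (inflow m e)) \<and>
      (\<forall>e<Suc i. (\<forall>N. \<exists>t. seen e t \<ge> N) \<or> (\<forall>t. ticks m e t = 0))"
    using eventually_unbounded[of "Suc i"] by blast
  have M: "unbounded (inflow m e)" "e \<notin> E \<Longrightarrow> ticks m e t = 0" if "m \<ge> M" "e \<le> i" for m e t
  proof -
    show "unbounded (inflow m e)" using M'[OF that(1)] that(2) by simp
    have "(\<forall>N. \<exists>t. seen e t \<ge> N) \<or> (\<forall>t. ticks m e t = 0)"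
      using M'[OF that(1)] le_imp_less_Suc[OF that(2)] by blast
    then show "ticks m e t = 0" if "e \<notin> E" using that \<open>e \<le> i\<close> unfolding E_def by blast
  qed
  have "\<exists>T. \<forall>u\<ge>T. \<forall>m<M'. \<forall>e\<le>m. gain m e u = 0" for M'
  proof (induction M')
    case (Suc M')
    then obtain T where "\<forall>u\<ge>T. \<forall>m<M'. \<forall>e\<le>m. gain m e u = 0" by blast
    moreover obtain T' where "\<forall>u\<ge>T'. \<forall>e\<le>M'. gain M' e u = 0" using row_eventually_0 by blast
    ultimately show ?case by (intro exI[of _ "max T T'"]) (auto simp: less_Suc_eq)
  qed simp
  then obtain T0 where T0: "\<And>u m e. u \<ge> T0 \<Longrightarrow> m < M \<Longrightarrow> e \<le> m \<Longrightarrow> gain m e u = 0" by blast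
  \<comment> \<open>Checks that the gates in \<open>E\<close> are past their second interval and
    that gate \<open>i\<close> has let \<open>2 ^ k\<close> pass since stage \<open>k\<close>; the
    additional tick pays for the slack in \<open>ticks_le_inflow\<close>.\<close>
  define P where "P t k \<longleftrightarrow> (\<forall>m<k. M \<le> m \<longrightarrow>
      ticks m i k + 2 ^ k + 1 \<le> ticks m i t \<and> (\<forall>e<Suc i. e \<in> E \<longrightarrow> 3 \<le> ticks m e t))" for t k
  have P_mono: "P u k" if "P t k" "t \<le> u" for t u k
    using that(1) unfolding P_def by (blast intro: order_trans[OF _ ticks_mono[OF that(2)]])
  have ticks_unb: "\<exists>t. N \<le> ticks m e t" if "m \<ge> M" "e \<in> E" for m e N
    by (rule ticks_unbounded) (use exists_tick[OF M(1)] that in \<open>auto simp: E_def\<close>)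
  have "i \<in> E" using i(1) by (simp add: E_def)
  have P_ex: "\<exists>t. P t k" for k
  proof -
    have "\<exists>t. ticks m i k + 2 ^ k + 1 \<le> ticks m i t \<and> (\<forall>e\<in>E. 3 \<le> ticks m e t)" if m: "m \<ge> M" for m
    proof -
      obtain t1 where t1: "ticks m i k + 2 ^ k + 1 \<le> ticks m i t1"
        using ticks_unb[OF m \<open>i \<in> E\<close>] by blast
      have "\<forall>e\<in>E. \<exists>t. 3 \<le> ticks m e t" using ticks_unb[OF m] by blast
      then obtain \<tau> where \<tau>: "\<And>e. e \<in> E \<Longrightarrow> 3 \<le> ticks m e (\<tau> e)"
        using bchoice[of E "\<lambda>e t. 3 \<le> ticks m e t"] by blast
      define t where "t = max t1 (Max (insert 0 (\<tau> ` E)))"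
      have "\<tau> e \<le> t" if "e \<in> E" for e
        using finE that by (auto simp: t_def intro!: le_max_iff_disj[THEN iffD2] disjI2 Max_ge)
      then have "\<forall>e\<in>E. 3 \<le> ticks m e t" using \<tau> by (blast intro: order_trans[OF _ ticks_mono])
      moreover have "ticks m i k + 2 ^ k + 1 \<le> ticks m i t"
        using t1 ticks_mono[of t1 t m i] by (simp add: t_def)
      ultimately show ?thesis by blast
    qed
    then have "\<forall>m\<in>{M..}. \<exists>t. ticks m i k + 2 ^ k + 1 \<le> ticks m i t \<and> (\<forall>e\<in>E. 3 \<le> ticks m e t)"
      by simp
    then obtain \<tau> where "\<forall>m\<in>{M..}. ticks m i k + 2 ^ k + 1 \<le> ticks m i (\<tau> m) \<and>
        (\<forall>e\<in>E. 3 \<le> ticks m e (\<tau> m))" by (rule bchoice[THEN exE])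
    then have \<tau>: "\<And>m. m \<ge> M \<Longrightarrow> ticks m i k + 2 ^ k + 1 \<le> ticks m i (\<tau> m) \<and>
        (\<forall>e\<in>E. 3 \<le> ticks m e (\<tau> m))" by simp
    define t where "t = Max (insert 0 (\<tau> ` {..<k}))"
    have "\<tau> m \<le> t" if "m < k" for m using that by (auto simp: t_def intro!: Max_ge)
    then have "P t k" unfolding P_def using \<tau> by (blast intro: order_trans[OF _ ticks_mono])
    then show ?thesis by blast
  qed
  \<comment> \<open>\<open>M\<close>, \<open>T0\<close>, \<open>E\<close> and \<open>i\<close> are
    constants built into the program, so a search for the witness of \<open>P\<close> suffices. The
    precision \<open>Suc k\<close> leaves room for adding two error terms.\<close>
  define f where "f k = T0 + Suc k + (LEAST t. P t (Suc k))" for k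
  have "computable_nat f"
  proof -
    have "recfn 1 (\<lambda>xs. LEAST t. P t (Suc (xs!0)))"
    proof (rule recfn_Least)
      show "recdec (Suc 1) (\<lambda>zs. P (zs!0) (Suc (drop 1 zs ! 0)))"
        unfolding P_def by (intro recfn_intros finE) simp_all
    qed (rule P_ex)
    then show ?thesis unfolding computable_nat_iff_recfn f_def by (intro recfn_intros) simp_all
  qed
  moreover have small: "approx (s (Suc n)) - approx (s n) < (1/2) ^ k" if "f k \<le> n" for n k
  proof -
    define K where "K = Suc k"
    define a where "a = s n"
    define b where "b = s (Suc n)"
    have "n \<le> a" unfolding a_def using s by (intro strict_mono_imp_increasing) blast
    have "a \<le> b" using s by (simp add: a_def b_def strict_mono_less_eq)
    have aT: "T0 \<le> a" "K \<le> a" and "P a K"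
    proof -
      have "(LEAST t. P t K) \<le> a" "T0 \<le> a" "K \<le> a"
        using that \<open>n \<le> a\<close> by (auto simp: f_def K_def)
      then show "T0 \<le> a" "K \<le> a" "P a K"
        using P_mono[OF LeastI_ex[of "\<lambda>t. P t K", OF P_ex]] by blast+
    qed
    \<comment> \<open>Gates up to \<open>i\<close> gain nothing any more; for the gates above, the
      at most 4 units that pass gate \<open>i\<close> are damped by \<open>2 ^ K\<close>. Rows from
      \<open>K\<close> on are small by their weight alone.\<close>
    have row: "(\<Sum>u\<in>{a..<b}. contrib m u) \<le> (2 / 2 ^ K) * (1/4) ^ Suc m" if "m < K" for m
    proof (rule sum_contrib_le_bound)
      fix e assume "e \<le> m"
      show "(\<Sum>u\<in>{a..<b}. gain m e u) \<le> 2 * (2 / 2 ^ K)"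
      proof (cases "m < M \<or> e \<le> i")
        case True
        have "gain m e u = 0" if "u \<ge> a" for u
        proof (cases "m < M")
          case True
          then show ?thesis using T0[of u m e] \<open>e \<le> m\<close> aT that by simp
        next
          case False
          then have "e \<le> i" using \<open>m < M \<or> e \<le> i\<close> by simp
          have "3 \<le> ticks m e a" if "e \<in> E"
            using \<open>P a K\<close> \<open>m < K\<close> False that le_imp_less_Suc[OF \<open>e \<le> i\<close>]
            unfolding P_def not_less by blast
          then have "ticks m e u = 0 \<or> 3 \<le> ticks m e a"
            using M(2)[of m e u] False \<open>e \<le> i\<close> by auto
          then have "ticks m e u \<noteq> 2" using ticks_mono[OF that, of m e] by auto
          then show ?thesis by (simp add: gain_def)
        qed
        then show ?thesis by simp
      next
        case False
        then have Pm: "ticks m i K + 2 ^ K + 1 \<le> ticks m i a"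
          using \<open>P a K\<close> \<open>m < K\<close> by (simp add: P_def)
        have "real (ticks m i a) \<le> ticks m i K + 1 + (inflow m (Suc i) a - inflow m (Suc i) K)"
          using Pm by (intro ticks_le_inflow aT) auto
        moreover have "real (ticks m i K + 2 ^ K + 1) \<le> real (ticks m i a)"
          using Pm by (simp only: of_nat_le_iff)
        ultimately have big: "inflow m (Suc i) K + 2 ^ K \<le> inflow m (Suc i) a" by simp
        have "(\<Sum>u\<in>{a..<b}. gain m e u) \<le> (\<Sum>u\<in>{a..<b}. flow m (Suc i) u / 2 ^ K)"
          using gain_le_flow[OF _ aT(2) _ big] False by (intro sum_mono) auto
        also have "\<dots> = (\<Sum>u\<in>{a..<b}. flow m (Suc i) u) / 2 ^ K" by (simp only: sum_divide_distrib)
        also have "\<dots> \<le> 4 / 2 ^ K"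
          unfolding a_def b_def using s i(2) Pm
          by (intro divide_right_mono flow_between_values) (auto simp: a_def)
        finally show ?thesis by simp
      qed
    qed simp
    have "approx b - approx a \<le> (\<Sum>m<b. \<Sum>u\<in>{a..<b}. contrib m u)" by (rule approx_diff_le[OF \<open>a \<le> b\<close>])
    also have "\<dots> = (\<Sum>m\<in>{0..<K}. \<Sum>u\<in>{a..<b}. contrib m u) + (\<Sum>m\<in>{K..<b}. \<Sum>u\<in>{a..<b}. contrib m u)"
      unfolding lessThan_atLeast0 using aT \<open>a \<le> b\<close> by (subst sum.atLeastLessThan_concat) auto
    also have "\<dots> \<le> (\<Sum>m\<in>{0..<K}. (2 / 2 ^ K) * (1/4) ^ Suc m) + (\<Sum>m\<in>{K..<b}. (1/4) ^ Suc m)"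
      using row sum_contrib_le by (intro add_mono sum_mono) auto
    also have "\<dots> = (2 / 2 ^ K) * (\<Sum>m\<in>{0..<K}. (1/4) ^ Suc m) + (\<Sum>m\<in>{K..<b}. (1/4) ^ Suc m)"
      by (simp only: sum_distrib_left)
    also have "\<dots> \<le> (2 / 2 ^ K) * ((1/4) ^ 0 / 3) + (1/4) ^ K / 3"
      by (intro add_mono mult_left_mono geometric_tail_le) auto
    also have "\<dots> \<le> (2 / 2 ^ K) * (1 / 3) + (1/2) ^ K / 3"
      by (intro add_mono divide_right_mono power_mono) auto
    \<comment> \<open>The two terms are 2/3 and 1/3 of \<open>(1/2) ^ K\<close>, and
      \<open>K = Suc k\<close>.\<close>
    also have "\<dots> < (1/2) ^ k" by (simp add: K_def power_divide field_simps)
    finally show ?thesis by (simp add: a_def b_def)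
  qed
  have mod: "is_modulus f (\<lambda>n. approx (s (Suc n)) - approx (s n)) 0"
    unfolding is_modulus_def
  proof (intro allI impI)
    fix k n assume "f k \<le> n"
    then have "approx (s (Suc n)) - approx (s n) < (1/2) ^ k" by (rule small)
    moreover have "approx (s n) \<le> approx (s (Suc n))" using s by (intro approx_mono) (simp add: strict_mono_less_eq)
    ultimately show "\<bar>0 - (approx (s (Suc n)) - approx (s n))\<bar> < (1/2) ^ k" by simp
  qed
  have "(\<lambda>n. approx (s (Suc n)) - approx (s n)) \<longlonglongrightarrow> approx_lim - approx_lim"
  proof (rule tendsto_diff)
    have "(\<lambda>n. approx (s n)) \<longlonglongrightarrow> approx_lim"
      using LIMSEQ_subseq_LIMSEQ[OF approx_tendsto] s by (simp add: o_def)
    then show "(\<lambda>n. approx (s n)) \<longlonglongrightarrow> approx_lim" "(\<lambda>n. approx (s (Suc n))) \<longlonglongrightarrow> approx_lim"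
      by (auto intro: LIMSEQ_Suc)
  qed
  then show "converges_computably_to (\<lambda>n. approx (s (Suc n)) - approx (s n)) 0"
    unfolding converges_computably_to_def using mod \<open>computable_nat f\<close> by auto
qed

theorem mainTheorem2:
  shows "\<exists>x::real. regainingly_approximable x \<and> nearly_computable x \<and> \<not> computable_real x"
proof (intro exI conjI)
  show "regainingly_approximable approx_lim" by (rule regainingly_approximable_approx_lim)
  show "\<not> computable_real approx_lim" by (rule not_computable_approx_lim)
  show "nearly_computable approx_lim"
    unfolding nearly_computable_def using computable_approx_rat converges_nearly_computably_approx
    by (intro exI[of _ approx_rat]) (simp add: real_of_approx_rat)
qed

end
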